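(* Let $\mathbb H^d$ denote real hyperbolic $d$-space. Then $\mathrm{TO}^q_{\mathbb{H}^d}(r) \lesssim r^{1-1/(d-q)}$ for $2 \leq q \leq d-2$, and $\mathrm{TO}^{d-1}_{\mathbb{H}^d}(r)\lesssim \ln(1+r)^2$.
   Context: For a metric space $X$ and $Z\subseteq X$, $\mathrm{Cov}^1(Z)$ is the minimal number of closed radius-$1$ balls of $X$ covering $Z$. For continuous $f:Z\to\mathbb R^q$, $\mathrm{Ov}(f)=\sup_{z}\mathrm{Cov}^1(f^{-1}(z))$, $\mathrm{TO}^q(Z)=\min_f\mathrm{Ov}(f)$, $\mathrm{TO}^q_X(r)=\max\{\mathrm{TO}^q(Z): Z\subseteq X,\mathrm{Cov}^1(Z)\le r\}$. $f\lesssim g$ means there is $C$ with $f(r)\le Cg(Cr)+C$ for all $r$. *)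

theory Defs
  imports "HOL-Analysis.Analysis" "HOL-Library.Extended_Nat"
begin

text \<open>Real hyperbolic d-space, upper half-space model: points are vectors
  x :: nat => real with x i = 0 for i >= d and last coordinate x (d-1) > 0.\<close>

definition hyp :: "nat \<Rightarrow> (nat \<Rightarrow> real) set" where
  "hyp d = {x. 0 < x (d - 1) \<and> (\<forall>i\<ge>d. x i = 0)}"

definition hdist :: "nat \<Rightarrow> (nat \<Rightarrow> real) \<Rightarrow> (nat \<Rightarrow> real) \<Rightarrow> real" where
  "hdist d x y = arcosh (1 + (\<Sum>i<d. (x i - y i)^2) / (2 * x (d - 1) * y (d - 1)))"

definition Rq :: "nat \<Rightarrow> (nat \<Rightarrow> real) set" where
  "Rq q = {v. \<forall>i\<ge>q. v i = 0}"

definition eucl_dist :: "nat \<Rightarrow> (nat \<Rightarrow> real) \<Rightarrow> (nat \<Rightarrow> real) \<Rightarrow> real" where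
  "eucl_dist q u v = sqrt (\<Sum>i<q. (u i - v i)^2)"

text \<open>Cov^1(Z): minimal number of closed radius-1 balls of (X,D) covering Z
  (infinity if no finite cover exists).\<close>

definition cov1 :: "'a set \<Rightarrow> ('a \<Rightarrow> 'a \<Rightarrow> real) \<Rightarrow> 'a set \<Rightarrow> enat" where
  "cov1 X D Z = (INF C \<in> {C. C \<subseteq> X \<and> finite C \<and> Z \<subseteq> (\<Union>c\<in>C. {x\<in>X. D c x \<le> 1})}.
                    enat (card C))"

definition cont_into :: "('a \<Rightarrow> 'a \<Rightarrow> real) \<Rightarrow> 'a set \<Rightarrow> nat \<Rightarrow> ('a \<Rightarrow> nat \<Rightarrow> real) \<Rightarrow> bool" where
  "cont_into D Z q f \<longleftrightarrow> f ` Z \<subseteq> Rq q \<and>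
     (\<forall>z\<in>Z. \<forall>e>0. \<exists>\<delta>>0. \<forall>w\<in>Z. D z w < \<delta> \<longrightarrow> eucl_dist q (f w) (f z) < e)"

definition Ov :: "'a set \<Rightarrow> ('a \<Rightarrow> 'a \<Rightarrow> real) \<Rightarrow> 'a set \<Rightarrow> ('a \<Rightarrow> nat \<Rightarrow> real) \<Rightarrow> enat" where
  "Ov X D Z f = (SUP y \<in> f ` Z. cov1 X D {z\<in>Z. f z = y})"

definition TO :: "'a set \<Rightarrow> ('a \<Rightarrow> 'a \<Rightarrow> real) \<Rightarrow> nat \<Rightarrow> 'a set \<Rightarrow> enat" where
  "TO X D q Z = (INF f \<in> {f. cont_into D Z q f}. Ov X D Z f)"

definition TOX :: "'a set \<Rightarrow> ('a \<Rightarrow> 'a \<Rightarrow> real) \<Rightarrow> nat \<Rightarrow> real \<Rightarrow> enat" where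
  "TOX X D q r = (SUP Z \<in> {Z. Z \<subseteq> X \<and> (\<exists>n. cov1 X D Z = enat n \<and> real n \<le> r)}. TO X D q Z)"

definition lesssim :: "(real \<Rightarrow> enat) \<Rightarrow> (real \<Rightarrow> real) \<Rightarrow> bool" where
  "lesssim F g \<longleftrightarrow> (\<exists>C>0. \<forall>r\<ge>0. \<exists>n. F r = enat n \<and> real n \<le> C * g (C * r) + C)"

end

theory Submission
  imports Defs
begin

text \<open>
  Write \<open>D = d - q\<close>. Vertical projection to the first \<open>q - 1\<close> horizontal coordinates has fibres that
  are totally geodesic copies of hyperbolic \<open>(D + 1)\<close>-space, and dropping those coordinates is a
  1-Lipschitz map onto one such copy. So a map to the line with small fibres on the image of \<open>Z\<close> in
  hyperbolic \<open>(D + 1)\<close>-space, paired with the projection, settles the general case.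

  To find it, cut the \<open>(D + 1)\<close>-dimensional upper half-space into dyadic cells of height and width
  \<open>2\<^sup>m\<close>. If the cells meeting \<open>Z\<close> are numbered so that few of them precede some number \<open>t\<close> while
  having a neighbour after \<open>t\<close>, then averaging the numbers with a partition of unity gives a function
  with small fibres. Such a numbering comes from recursive balanced separators: the separator first,
  then one side, then the other. A separator of \<open>n\<close> cells is a box-shaped dome over the boundary: take the
  smallest dome, of radius \<open>R\<close>, that contains a fixed proportion of the cells, and then a random radius
  in \<open>[R, 2 R]\<close>. A cell of side \<open>s\<close> is hit with probability of order \<open>s / R\<close>, and there are
  at most about \<open>(R / s)\<^sup>D\<close> of them, so the expected number of hits is of order \<open>n powr (1 - 1 / D)\<close> for
  \<open>D \<ge> 2\<close> and \<open>ln n\<close> for \<open>D = 1\<close>; summing over the recursion keeps the former and squares the latter.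
\<close>

section \<open>Counting lattice points\<close>

lemma int_interval_card:
  fixes b h :: real
  assumes "0 \<le> h"
  shows "real (card {\<lceil>b - h\<rceil>..\<lfloor>b + h\<rfloor>}) \<le> 2 * h + 1"
proof -
  have "real_of_int (\<lfloor>b + h\<rfloor> - \<lceil>b - h\<rceil> + 1) \<le> 2 * h + 1"
    using of_int_floor_le[of "b + h"] le_of_int_ceiling[of "b - h"] by linarith
  then show ?thesis using assms
    by (cases "0 \<le> \<lfloor>b + h\<rfloor> - \<lceil>b - h\<rceil> + 1") simp_all
qed

lemma int_box_card:
  fixes b :: "nat \<Rightarrow> real"
  assumes "0 \<le> h"
  shows "finite {v \<in> extensional {..<D}. \<forall>i<D. \<bar>real_of_int (v i) - b i\<bar> \<le> h}" (is "finite ?B")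
    and "real (card {v \<in> extensional {..<D}. \<forall>i<D. \<bar>real_of_int (v i) - b i\<bar> \<le> h}) \<le> (2 * h + 1) ^ D"
proof -
  let ?P = "Pi\<^sub>E {..<D} (\<lambda>i. {\<lceil>b i - h\<rceil>..\<lfloor>b i + h\<rfloor>})"
  have sub: "?B \<subseteq> ?P"
  proof
    fix v assume v: "v \<in> ?B"
    have "v i \<in> {\<lceil>b i - h\<rceil>..\<lfloor>b i + h\<rfloor>}" if "i < D" for i
      using v that by (auto simp: ceiling_le_iff le_floor_iff abs_le_iff)
    then show "v \<in> ?P" using v by (auto simp: PiE_def)
  qed
  have fin: "finite ?P" by (intro finite_PiE) auto
  show "finite ?B" using sub fin by (rule finite_subset)
  have "real (card ?B) \<le> real (card ?P)" using card_mono[OF fin sub] by simp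
  also have "\<dots> = (\<Prod>i<D. real (card {\<lceil>b i - h\<rceil>..\<lfloor>b i + h\<rfloor>}))"
    by (simp add: card_PiE)
  also have "\<dots> \<le> (\<Prod>i<D. 2 * h + 1)"
    by (intro prod_mono conjI int_interval_card assms) simp
  finally show "real (card ?B) \<le> (2 * h + 1) ^ D" by simp
qed

section \<open>Numberings with small cuts\<close>

text \<open>Both inequalities are weak: a mean of numbers can equal the number of every cell it
  averages, and then \<open>w' = w\<close> has to serve as the neighbour.\<close>

definition cut_set :: "('a \<Rightarrow> 'a \<Rightarrow> bool) \<Rightarrow> 'a set \<Rightarrow> ('a \<Rightarrow> nat) \<Rightarrow> real \<Rightarrow> 'a set" where
  "cut_set adj W idx t = {w\<in>W. real (idx w) \<le> t \<and> (\<exists>w'\<in>W. adj w w' \<and> t \<le> real (idx w'))}"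

text \<open>With S numbered first, then A, then B, every cut lies in S together with a cut of only
  one of A and B, because no cell of A has a neighbour in B. So \<open>H\<close> has to absorb
  \<open>s\<close> along a single branch of the recursion only.\<close>

lemma cut_recursion:
  fixes adj :: "'a \<Rightarrow> 'a \<Rightarrow> bool" and H s :: "nat \<Rightarrow> real"
  assumes split: "\<And>W. \<lbrakk>finite W; W \<subseteq> U; n0 \<le> card W\<rbrakk> \<Longrightarrow>
      \<exists>S A B. W = S \<union> A \<union> B \<and> S \<inter> A = {} \<and> S \<inter> B = {} \<and> A \<inter> B = {} \<and>
        (\<forall>w\<in>A. \<forall>w'\<in>B. \<not> adj w w') \<and> real (card S) \<le> s (card W) \<and>
        real (card A) \<le> \<beta> * real (card W) \<and> real (card B) \<le> \<beta> * real (card W)"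
    and \<beta>: "\<beta> < 1" and n0: "0 < n0"
    and small: "\<And>n. n < n0 \<Longrightarrow> real n \<le> H n"
    and step: "\<And>m n. \<lbrakk>n0 \<le> n; real m \<le> \<beta> * real n\<rbrakk> \<Longrightarrow> s n + H m \<le> H n"
    and W: "finite W" "W \<subseteq> U"
  shows "\<exists>idx :: 'a \<Rightarrow> nat. \<forall>t. real (card (cut_set adj W idx t)) \<le> H (card W)"
  using W
proof (induction "card W" arbitrary: W rule: less_induct)
  case less
  show ?case
  proof (cases "card W < n0")
    case True
    have "real (card (cut_set adj W (\<lambda>_. 0) t)) \<le> H (card W)" for t
    proof -
      have "card (cut_set adj W (\<lambda>_. 0) t) \<le> card W"
        using less.prems(1) by (intro card_mono) (auto simp: cut_set_def)
      then show ?thesis using small[OF True] by linarith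
    qed
    then show ?thesis by blast
  next
    case False
    then have n: "n0 \<le> card W" by simp
    obtain S A B where W: "W = S \<union> A \<union> B" and disj: "S \<inter> A = {}" "S \<inter> B = {}" "A \<inter> B = {}"
      and nadj: "\<And>w w'. w \<in> A \<Longrightarrow> w' \<in> B \<Longrightarrow> \<not> adj w w'"
      and cS: "real (card S) \<le> s (card W)"
      and cA: "real (card A) \<le> \<beta> * real (card W)" and cB: "real (card B) \<le> \<beta> * real (card W)"
      using split[OF less.prems n] by blast
    have fin: "finite S" "finite A" "finite B" using less.prems(1) W by auto
    have "\<beta> * real (card W) < real (card W)" using \<beta> n n0 by auto
    then have lt: "card A < card W" "card B < card W" using cA cB by linarith+
    obtain f where f: "\<And>t. real (card (cut_set adj A f t)) \<le> H (card A)"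
      using less.hyps[OF lt(1) fin(2)] less.prems(2) W by auto
    obtain g where g: "\<And>t. real (card (cut_set adj B g t)) \<le> H (card B)"
      using less.hyps[OF lt(2) fin(3)] less.prems(2) W by auto
    obtain N where N: "\<And>w. w \<in> A \<Longrightarrow> f w < N"
      using finite_nat_set_iff_bounded[of "f ` A"] fin(2) by auto
    \<comment> \<open>A receives numbers from 1 to N and B numbers from N + 1 on, so comparing t
      with N + 1 decides which of the two a cut can touch.\<close>
    define h where "h w = (if w \<in> S then 0 else if w \<in> A then Suc (f w) else Suc (N + g w))" for w
    have hS: "h w = 0" if "w \<in> S" for w using that by (simp add: h_def)
    have hA: "h w = Suc (f w)" if "w \<in> A" for w using that disj by (auto simp: h_def)
    have hB: "h w = Suc (N + g w)" if "w \<in> B" for w using that disj by (auto simp: h_def)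
    have "real (card (cut_set adj W h t)) \<le> H (card W)" for t
    proof (cases "t < real N + 1")
      case True
      have "cut_set adj W h t \<subseteq> S \<union> cut_set adj A f (t - 1)"
      proof
        fix w assume "w \<in> cut_set adj W h t"
        then obtain w' where w: "w \<in> W" "real (h w) \<le> t" "w' \<in> W" "adj w w'" "t \<le> real (h w')"
          by (auto simp: cut_set_def)
        have "w \<notin> B" using w(2) True hB[of w] by auto
        moreover have "w \<in> cut_set adj A f (t - 1)" if "w \<in> A"
        proof -
          have "w' \<notin> B" using nadj[OF that] w(4) by blast
          moreover have "w' \<notin> S" using w(2,5) hS[of w'] hA[OF that] by auto
          ultimately have "w' \<in> A" using w(3) W by auto
          then show ?thesis using w hA[of w'] hA[OF that] that by (auto simp: cut_set_def)
        qed
        ultimately show "w \<in> S \<union> cut_set adj A f (t - 1)" using w(1) W by auto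
      qed
      then have "card (cut_set adj W h t) \<le> card (S \<union> cut_set adj A f (t - 1))"
        using fin by (intro card_mono) (auto simp: cut_set_def)
      also have "\<dots> \<le> card S + card (cut_set adj A f (t - 1))" by (rule card_Un_le)
      finally show ?thesis using f[of "t - 1"] cS step[OF n cA] by linarith
    next
      case False
      have "cut_set adj W h t \<subseteq> S \<union> cut_set adj B g (t - real N - 1)"
      proof
        fix w assume "w \<in> cut_set adj W h t"
        then obtain w' where w: "w \<in> W" "real (h w) \<le> t" "w' \<in> W" "adj w w'" "t \<le> real (h w')"
          by (auto simp: cut_set_def)
        have "w' \<notin> S" using w(5) False hS[of w'] by auto
        moreover have "w' \<notin> A" using w(5) False hA[of w'] N[of w'] by auto
        ultimately have w'B: "w' \<in> B" using w(3) W by auto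
        have "w \<notin> A" using nadj[OF _ w'B] w(4) by blast
        moreover have "w \<in> cut_set adj B g (t - real N - 1)" if "w \<in> B"
          using w w'B hB[of w'] hB[OF that] that by (auto simp: cut_set_def)
        ultimately show "w \<in> S \<union> cut_set adj B g (t - real N - 1)" using w(1) W by auto
      qed
      then have "card (cut_set adj W h t) \<le> card (S \<union> cut_set adj B g (t - real N - 1))"
        using fin by (intro card_mono) (auto simp: cut_set_def)
      also have "\<dots> \<le> card S + card (cut_set adj B g (t - real N - 1))" by (rule card_Un_le)
      finally show ?thesis using g[of "t - real N - 1"] cS step[OF n cB] by linarith
    qed
    then show ?thesis by blast
  qed
qed

section \<open>Separators of dyadic cells\<close>

text \<open>A mean over finitely many radii replaces the random radius: those whose shell contains
  \<open>w\<close> fill an interval of length at most \<open>\<kappa> * s w\<close> out of R, and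
  some radius does no worse than the mean.\<close>

lemma thin_shell:
  fixes \<rho> s :: "'a \<Rightarrow> real"
  assumes W: "finite W" and R: "0 < R" and \<kappa>: "0 \<le> \<kappa>" and s: "\<And>w. w \<in> W \<Longrightarrow> 0 \<le> s w"
  shows "\<exists>\<mu>. R \<le> \<mu> \<and> \<mu> \<le> 2 * R \<and>
    real (card {w\<in>W. \<rho> w \<le> \<mu> \<and> \<mu> < \<rho> w + \<kappa> * s w}) \<le> 1 + \<kappa> / R * (\<Sum>w | w \<in> W \<and> \<rho> w \<le> 2 * R. s w)"
proof (cases "W = {}")
  case True
  then show ?thesis using R by (intro exI[of _ R]) auto
next
  case False
  \<comment> \<open>With \<open>card W\<close> equally spaced radii, rounding costs at most 1 per
    cell of V, hence at most L in total; this is the summand 1 of the bound.\<close>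
  define L where "L = card W"
  define V where "V = {w\<in>W. \<rho> w \<le> 2 * R}"
  have L: "0 < L" using False W by (simp add: L_def card_gt_0_iff)
  define lam where "lam i = R * (1 + real i / real L)" for i
  define S where "S i = {w\<in>W. \<rho> w \<le> lam i \<and> lam i < \<rho> w + \<kappa> * s w}" for i
  have finV: "finite V" using W by (simp add: V_def)
  have lam: "R \<le> lam i" "lam i \<le> 2 * R" if "i < L" for i
    using that R by (auto simp: lam_def field_simps)
  have SV: "S i \<subseteq> V" if "i < L" for i using lam[OF that] by (auto simp: S_def V_def)
  have cnt: "real (card {i\<in>{..<L}. w \<in> S i}) \<le> \<kappa> * s w * real L / R + 1" if "w \<in> V" for w
  proof -
    \<comment> \<open>In units of the spacing R / L, the indices whose shell contains
      \<open>w\<close> lie in an interval with midpoint b and half-length h.\<close>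
    define h where "h = \<kappa> * s w * real L / R / 2"
    define b where "b = (\<rho> w / R - 1) * real L + h"
    have h0: "0 \<le> h" using \<kappa> R s[of w] that by (auto simp: h_def V_def)
    have sub: "int ` {i\<in>{..<L}. w \<in> S i} \<subseteq> {\<lceil>b - h\<rceil>..\<lfloor>b + h\<rfloor>}"
    proof
      fix x assume "x \<in> int ` {i\<in>{..<L}. w \<in> S i}"
      then obtain i where i: "x = int i" "\<rho> w \<le> lam i" "lam i < \<rho> w + \<kappa> * s w" by (auto simp: S_def)
      have 1: "b - h \<le> real i" using i(2) R L by (simp add: b_def lam_def field_simps)
      have "real i = (lam i / R - 1) * real L" using R L by (simp add: lam_def)
      also have "\<dots> \<le> ((\<rho> w + \<kappa> * s w) / R - 1) * real L"
        using i(3) R by (intro mult_right_mono diff_right_mono divide_right_mono) auto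
      also have "\<dots> = b + h" using R by (simp add: b_def h_def field_simps)
      finally show "x \<in> {\<lceil>b - h\<rceil>..\<lfloor>b + h\<rfloor>}" using 1 i(1) by (simp add: ceiling_le_iff le_floor_iff)
    qed
    have "card {i\<in>{..<L}. w \<in> S i} = card (int ` {i\<in>{..<L}. w \<in> S i})"
      by (simp add: card_image)
    also have "\<dots> \<le> card {\<lceil>b - h\<rceil>..\<lfloor>b + h\<rfloor>}" using sub by (intro card_mono) auto
    finally have "real (card {i\<in>{..<L}. w \<in> S i}) \<le> 2 * h + 1"
      using int_interval_card[OF h0, of b] by linarith
    then show ?thesis by (simp add: h_def)
  qed
  define X where "X = 1 + \<kappa> / R * (\<Sum>w\<in>V. s w)"
  have "(\<Sum>i<L. real (card (S i))) = (\<Sum>i<L. \<Sum>w\<in>V. if w \<in> S i then 1 else 0)"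
  proof (rule sum.cong)
    fix i assume "i \<in> {..<L}"
    then have "V \<inter> {w. w \<in> S i} = S i" using SV by auto
    then show "real (card (S i)) = (\<Sum>w\<in>V. if w \<in> S i then 1 else 0)"
      using finV by (simp add: sum.If_cases)
  qed simp
  also have "\<dots> = (\<Sum>w\<in>V. \<Sum>i<L. if w \<in> S i then 1 else 0)" by (rule sum.swap)
  also have "\<dots> = (\<Sum>w\<in>V. real (card {i\<in>{..<L}. w \<in> S i}))"
    by (intro sum.cong) (simp_all add: sum.If_cases Int_def)
  also have "\<dots> \<le> (\<Sum>w\<in>V. \<kappa> * s w * real L / R + 1)" by (intro sum_mono cnt)
  also have "\<dots> = real L * (\<kappa> / R * (\<Sum>w\<in>V. s w)) + real (card V)"
    by (simp add: sum.distrib sum_distrib_left sum_divide_distrib mult_ac)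
  also have "\<dots> \<le> real L * X"
  proof -
    have "card V \<le> L" unfolding L_def V_def using W by (intro card_mono) auto
    then show ?thesis by (simp add: X_def algebra_simps)
  qed
  finally have tot: "(\<Sum>i<L. real (card (S i))) \<le> real L * X" .
  have "\<exists>i<L. real (card (S i)) \<le> X"
  proof (rule ccontr)
    assume "\<not> ?thesis"
    then have "(\<Sum>i<L. X) < (\<Sum>i<L. real (card (S i)))" using L by (intro sum_strict_mono) auto
    then show False using tot by simp
  qed
  then obtain i where "i < L" "real (card (S i)) \<le> X" by blast
  then show ?thesis using lam[of i] unfolding S_def X_def V_def by (intro exI[of _ "lam i"]) auto
qed

text \<open>Here \<open>l w\<close> is the depth of \<open>w\<close> below the largest scale. Above
  depth J the count per scale is used; from J on, each cell weighs at most
  \<open>(1 / 2) ^ J\<close> and there are at most \<open>2 ^ (J * D)\<close> of them. The sum over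
  scales equals J for \<open>D = 1\<close>, the source of a logarithm, and is geometric for
  \<open>D \<ge> 2\<close>.\<close>

lemma scale_sum:
  fixes l :: "'a \<Rightarrow> nat"
  assumes V: "finite V" "card V \<le> n" and P: "0 \<le> P" and D: "1 \<le> D"
    and cnt: "\<And>i. real (card {w\<in>V. l w = i}) \<le> P * 2 ^ (i * D)"
    and J: "n \<le> 2 ^ (J * D)"
  shows "(\<Sum>w\<in>V. (1 / 2) ^ l w) \<le> P * (\<Sum>i<J. 2 ^ (i * (D - 1))) + (2::real) ^ (J * (D - 1))"
proof -
  define V1 where "V1 = {w\<in>V. l w < J}"
  define V2 where "V2 = {w\<in>V. \<not> l w < J}"
  have pw: "(2::real) ^ (i * D) * (1 / 2) ^ i = 2 ^ (i * (D - 1))" for i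
  proof -
    have "i * D = i * (D - 1) + i" using D by (simp add: algebra_simps flip: mult_Suc_right)
    then show ?thesis by (simp add: power_add power_divide)
  qed
  have "(\<Sum>w\<in>V1. (1 / 2) ^ l w) = (\<Sum>i<J. \<Sum>w | w \<in> V1 \<and> l w = i. (1 / 2) ^ l w :: real)"
    using V by (subst sum.group) (auto simp: V1_def)
  also have "\<dots> = (\<Sum>i<J. real (card {w\<in>V. l w = i}) * (1 / 2) ^ i)"
  proof (intro sum.cong refl)
    fix i assume "i \<in> {..<J}"
    then have "{w. w \<in> V1 \<and> l w = i} = {w\<in>V. l w = i}" by (auto simp: V1_def)
    then show "(\<Sum>w | w \<in> V1 \<and> l w = i. (1 / 2) ^ l w :: real) = real (card {w\<in>V. l w = i}) * (1 / 2) ^ i"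
      by simp
  qed
  also have "\<dots> \<le> (\<Sum>i<J. P * 2 ^ (i * D) * (1 / 2) ^ i)"
    by (intro sum_mono mult_right_mono cnt) simp
  also have "\<dots> = P * (\<Sum>i<J. 2 ^ (i * (D - 1)))"
    by (simp add: sum_distrib_left mult.assoc pw)
  finally have 1: "(\<Sum>w\<in>V1. (1 / 2) ^ l w) \<le> P * (\<Sum>i<J. 2 ^ (i * (D - 1)) :: real)" .
  have "(\<Sum>w\<in>V2. (1 / 2) ^ l w) \<le> (\<Sum>w\<in>V2. (1 / 2) ^ J :: real)"
    by (intro sum_mono power_decreasing) (auto simp: V2_def)
  also have "\<dots> \<le> 2 ^ (J * D) * (1 / 2) ^ J"
  proof -
    have "card V2 \<le> card V" using V by (intro card_mono) (auto simp: V2_def)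
    then have "card V2 \<le> 2 ^ (J * D)" using V(2) J by linarith
    then have "real (card V2) \<le> 2 ^ (J * D)" by (simp flip: of_nat_le_iff)
    then show ?thesis by (simp add: mult_right_mono)
  qed
  finally have 2: "(\<Sum>w\<in>V2. (1 / 2) ^ l w) \<le> (2::real) ^ (J * (D - 1))" by (simp add: pw)
  have "(\<Sum>w\<in>V. (1 / 2) ^ l w) = (\<Sum>w\<in>V1. (1 / 2) ^ l w) + (\<Sum>w\<in>V2. (1 / 2) ^ l w :: real)"
    using V unfolding V1_def V2_def by (subst sum.union_disjoint[symmetric]) (auto intro: sum.cong)
  then show ?thesis using 1 2 by linarith
qed

section \<open>Dyadic cells and domes\<close>

text \<open>The cell \<open>(m, v)\<close> lies over the cube with side \<open>2\<^sup>m\<close> and lowest corner \<open>2\<^sup>m v\<close>, at heights between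
  \<open>2\<^sup>m\<close> and \<open>2\<^sup>m\<^sup>+\<^sup>1\<close>.\<close>

type_synonym cell = "int \<times> (nat \<Rightarrow> int)"

definition cells :: "nat \<Rightarrow> cell set" where
  "cells D = UNIV \<times> extensional {..<D}"

definition side :: "cell \<Rightarrow> real" where
  "side w = 2 powr real_of_int (fst w)"

definition corner :: "cell \<Rightarrow> nat \<Rightarrow> real" where
  "corner w i = side w * real_of_int (snd w i)"

text \<open>The dome of radius \<open>\<mu>\<close> around the boundary point \<open>a\<close> consists of the cells \<open>w\<close> with
  \<open>dome D a w \<le> \<mu>\<close>.\<close>

definition dome :: "nat \<Rightarrow> (nat \<Rightarrow> real) \<Rightarrow> cell \<Rightarrow> real" where
  "dome D a w = Max (insert (side w) ((\<lambda>i. \<bar>corner w i - a i\<bar>) ` {..<D}))"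

text \<open>A relation containing all pairs of cells whose bumps (defined below) have overlapping supports.\<close>

definition adj :: "nat \<Rightarrow> cell \<Rightarrow> cell \<Rightarrow> bool" where
  "adj D w w' \<longleftrightarrow> side w' \<le> 8 * side w \<and> (\<forall>i<D. \<bar>corner w' i - corner w i\<bar> \<le> 18 * side w)"

lemma side_pos [simp]: "0 < side w"
  by (simp add: side_def)

lemma side_neq_0 [simp]: "side w \<noteq> 0"
  by (simp add: side_def)

lemma dome_le_iff: "dome D a w \<le> x \<longleftrightarrow> side w \<le> x \<and> (\<forall>i<D. \<bar>corner w i - a i\<bar> \<le> x)"
  by (auto simp: dome_def)

text \<open>This keeps neighbours from jumping across a shell whose thickness at \<open>w\<close> is
  \<open>18 * side w\<close>.\<close>

lemma dome_adj:
  assumes "adj D w w'"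
  shows "dome D a w' \<le> dome D a w + 18 * side w"
proof -
  have d: "side w \<le> dome D a w" "\<And>i. i < D \<Longrightarrow> \<bar>corner w i - a i\<bar> \<le> dome D a w"
    using dome_le_iff[of D a w "dome D a w"] by auto
  have "\<bar>corner w' i - a i\<bar> \<le> dome D a w + 18 * side w" if "i < D" for i
  proof -
    have "\<bar>corner w' i - corner w i\<bar> \<le> 18 * side w" using assms that by (auto simp: adj_def)
    then show ?thesis using d(2)[OF that] by linarith
  qed
  moreover have "side w' \<le> dome D a w + 18 * side w"
  proof -
    have "side w' \<le> 8 * side w" using assms by (auto simp: adj_def)
    then show ?thesis using d(1) side_pos[of w] by linarith
  qed
  ultimately show ?thesis by (simp add: dome_le_iff)
qed

text \<open>Dividing by the side s turns corners into lattice points of a cube of half-width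
  \<open>h = 2 * R / s\<close>. The hypothesis says \<open>1 \<le> h\<close>, so
  \<open>2 * h + 1 \<le> 3 * h\<close>.\<close>

lemma scale_count:
  assumes R: "2 powr real_of_int m \<le> 2 * R"
  shows "finite {w\<in>cells D. fst w = m \<and> dome D a w \<le> 2 * R}" (is "finite ?A")
    and "real (card {w\<in>cells D. fst w = m \<and> dome D a w \<le> 2 * R}) \<le> (6 * R / 2 powr real_of_int m) ^ D"
proof -
  define s where "s = 2 powr real_of_int m"
  have s: "0 < s" "s \<le> 2 * R" using R by (auto simp: s_def)
  define h where "h = 2 * R / s"
  have h: "1 \<le> h" using s by (simp add: h_def)
  define B where "B = {v \<in> extensional {..<D}. \<forall>i<D. \<bar>real_of_int (v i) - a i / s\<bar> \<le> h}"
  have B: "finite B" "real (card B) \<le> (2 * h + 1) ^ D"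
    unfolding B_def using h int_box_card[of h D "\<lambda>i. a i / s"] by auto
  have "?A \<subseteq> Pair m ` B"
  proof
    fix w assume w: "w \<in> ?A"
    have "\<bar>real_of_int (snd w i) - a i / s\<bar> \<le> h" if "i < D" for i
    proof -
      have "\<bar>s * (real_of_int (snd w i) - a i / s)\<bar> \<le> 2 * R"
        using w that s(1) by (auto simp: dome_le_iff corner_def side_def s_def right_diff_distrib)
      then have "s * \<bar>real_of_int (snd w i) - a i / s\<bar> \<le> 2 * R" using s(1) by (simp only: abs_mult abs_of_pos)
      then show ?thesis using s(1) by (simp add: h_def field_simps)
    qed
    then have "snd w \<in> B" using w by (auto simp: B_def cells_def)
    moreover have "w = (m, snd w)" using w by (cases w) auto
    ultimately show "w \<in> Pair m ` B" by blast
  qed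
  then show "finite ?A" using B(1) by (meson finite_imageI finite_subset)
  have "card ?A \<le> card (Pair m ` B)" using B(1) \<open>?A \<subseteq> _\<close> by (intro card_mono) auto
  also have "\<dots> \<le> card B" using B(1) by (rule card_image_le)
  finally have "real (card ?A) \<le> (2 * h + 1) ^ D" using B(2) by linarith
  also have "\<dots> \<le> (3 * h) ^ D" using h by (intro power_mono) auto
  finally show "real (card ?A) \<le> (6 * R / 2 powr real_of_int m) ^ D" by (simp add: h_def s_def)
qed

section \<open>Balanced domes and separators\<close>

text \<open>Radii are powers of 2, so that a least one exists. The search starts at the smallest
  side in W: below it a dome contains no cell, since \<open>dome\<close> is at least
  \<open>side\<close>, so minimality also holds at the first radius.\<close>

lemma minimal_dome:
  assumes W: "finite W" "W \<noteq> {}" and K: "1 \<le> K"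
  shows "\<exists>a j. real (card W) / K \<le> real (card {w\<in>W. dome D a w \<le> 2 powr real_of_int j}) \<and>
    (\<forall>b. real (card {w\<in>W. dome D b w \<le> 2 powr real_of_int (j - 1)}) \<le> real (card W) / K)"
proof -
  define i where "i = Min (fst ` W)"
  define P where "P k \<longleftrightarrow> (\<exists>a. real (card W) / K \<le> real (card {w\<in>W. dome D a w \<le> 2 powr real_of_int (i + int k)}))" for k
  have "\<exists>k. P k"
  proof -
    define M where "M = Max (insert 1 (dome D (\<lambda>_. 0) ` W))"
    have M: "1 \<le> M" "\<And>w. w \<in> W \<Longrightarrow> dome D (\<lambda>_. 0) w \<le> M" using W(1) by (auto simp: M_def)
    define k where "k = nat (\<lceil>log 2 M\<rceil> - i)"
    have "log 2 M \<le> real_of_int \<lceil>log 2 M\<rceil>" by simp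
    also have "\<dots> \<le> real_of_int (i + int k)" by (simp add: k_def)
    finally have "2 powr (log 2 M) \<le> 2 powr real_of_int (i + int k)" by (intro powr_mono) auto
    then have "M \<le> 2 powr real_of_int (i + int k)" using M(1) by simp
    then have "{w\<in>W. dome D (\<lambda>_. 0) w \<le> 2 powr real_of_int (i + int k)} = W"
      using M(2) by force
    moreover have "real (card W) / K \<le> real (card W)" using K mult_right_mono[of 1 K "real (card W)"] by (simp add: field_simps)
    ultimately have "P k" unfolding P_def by (intro exI[of _ "\<lambda>_. 0"]) simp
    then show ?thesis by blast
  qed
  then have ex: "P (LEAST k. P k)" by (rule LeastI_ex)
  define k where "k = (LEAST k. P k)"
  obtain a where a: "real (card W) / K \<le> real (card {w\<in>W. dome D a w \<le> 2 powr real_of_int (i + int k)})"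
    using ex by (auto simp: P_def k_def)
  have "real (card {w\<in>W. dome D b w \<le> 2 powr real_of_int (i + int k - 1)}) \<le> real (card W) / K" for b
  proof (cases k)
    case 0
    have "\<not> dome D b w \<le> 2 powr real_of_int (i - 1)" if "w \<in> W" for w
    proof
      assume "dome D b w \<le> 2 powr real_of_int (i - 1)"
      then have "2 powr real_of_int (fst w) \<le> 2 powr real_of_int (i - 1)"
        by (simp add: dome_le_iff side_def)
      then have "fst w \<le> i - 1" by (subst (asm) powr_le_cancel_iff) linarith+
      moreover have "i \<le> fst w" using that W by (simp add: i_def)
      ultimately show False by simp
    qed
    then have "{w\<in>W. dome D b w \<le> 2 powr real_of_int (i + int k - 1)} = {}" using 0 by auto
    then have "card {w\<in>W. dome D b w \<le> 2 powr real_of_int (i + int k - 1)} = 0" by (simp only: card.empty)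
    then show ?thesis using K by (simp only:) simp
  next
    case (Suc k')
    then have "\<not> P k'" using not_less_Least[of k' P] by (simp add: k_def)
    then show ?thesis using Suc by (auto simp: P_def not_le intro: less_imp_le)
  qed
  then show ?thesis using a by blast
qed

text \<open>Doubling the minimal radius R cannot take in too much: cells of side at most R / 2 lie
  in \<open>9 ^ D\<close> domes of radius R / 2, all light by minimality, and the larger ones are
  few.\<close>

lemma balanced_dome:
  assumes W: "finite W" "W \<subseteq> cells D" and n: "8 * 6 ^ D \<le> card W"
  shows "\<exists>a j. real (card W) / (2 * 9 ^ D) \<le> real (card {w\<in>W. dome D a w \<le> 2 powr real_of_int j}) \<and>
    real (card {w\<in>W. dome D a w \<le> 2 * 2 powr real_of_int j}) \<le> 3 / 4 * real (card W)"
proof -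
  define n where "n = real (card W)"
  \<comment> \<open>The factor \<open>9 ^ D\<close> cancels the number of half-radius domes in the
    covering, leaving \<open>n / 2\<close>.\<close>
  define K where "K = (2 * 9 ^ D :: real)"
  have n6: "8 * 6 ^ D \<le> n" using n of_nat_mono[of "8 * 6 ^ D" "card W", where ?'a = real] unfolding n_def by simp
  have W0: "W \<noteq> {}" using n by auto
  have "1 \<le> K" unfolding K_def using one_le_power[of "9::real" D] by linarith
  obtain a j where a: "n / K \<le> real (card {w\<in>W. dome D a w \<le> 2 powr real_of_int j})"
    and min: "\<And>b. real (card {w\<in>W. dome D b w \<le> 2 powr real_of_int (j - 1)}) \<le> n / K"
    using minimal_dome[OF W(1) W0 \<open>1 \<le> K\<close>, of D] unfolding n_def by blast
  define R where "R = 2 powr real_of_int j"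
  have R: "0 < R" by (simp add: R_def)
  have Rh: "2 powr real_of_int (j - 1) = R / 2" by (simp add: R_def powr_diff)
  have Rd: "2 powr real_of_int (j + 1) = 2 * R" by (simp add: R_def powr_add)
  define T where "T m = {w\<in>cells D. fst w = m \<and> dome D a w \<le> 2 * R}" for m
  \<comment> \<open>Cells of side R and \<open>2 * R\<close> are treated apart, since no dome of
    radius R / 2 contains them.\<close>
  define V where "V = {w\<in>W. fst w \<le> j - 1 \<and> dome D a w \<le> 2 * R}"
  have T1: "finite (T j)" "real (card (T j)) \<le> 6 ^ D"
    using scale_count[of j R D a] R by (simp_all add: T_def R_def)
  have T2: "finite (T (j + 1))" "real (card (T (j + 1))) \<le> 3 ^ D"
    using scale_count[of "j + 1" R D a] R by (simp_all only: T_def Rd) simp_all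
  \<comment> \<open>The half-radius domes are centred on a grid of mesh R / 2 around a. Corners are
    within \<open>2 * R\<close> of a, so each index runs from -4 to 4, nine values per
    coordinate.\<close>
  define code where "code w = restrict (\<lambda>i. \<lfloor>(corner w i - a i) / (R / 2)\<rfloor>) {..<D}" for w
  define B where "B = {v \<in> extensional {..<D}. \<forall>i<D. \<bar>real_of_int (v i) - 0\<bar> \<le> 4}"
  have B: "finite B" "real (card B) \<le> 9 ^ D"
    unfolding B_def using int_box_card[of 4 D "\<lambda>_. 0"] by auto
  define F where "F u = {w\<in>W. dome D (\<lambda>i. a i + R / 2 * real_of_int (u i)) w \<le> 2 powr real_of_int (j - 1)}" for u
  have "V \<subseteq> (\<Union>u\<in>B. F u)"
  proof
    fix w assume w: "w \<in> V"
    have cw: "\<bar>corner w i - a i\<bar> \<le> 2 * R" if "i < D" for i using w that by (auto simp: V_def dome_le_iff)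
    have "code w \<in> B"
    proof -
      have "\<bar>real_of_int \<lfloor>(corner w i - a i) / (R / 2)\<rfloor>\<bar> \<le> 4" if "i < D" for i
      proof -
        have "-4 \<le> (corner w i - a i) / (R / 2)" "(corner w i - a i) / (R / 2) \<le> 4"
          using cw[OF that] R by (auto simp: field_simps abs_le_iff)
        then have "-4 \<le> \<lfloor>(corner w i - a i) / (R / 2)\<rfloor>" "\<lfloor>(corner w i - a i) / (R / 2)\<rfloor> \<le> 4"
          by (auto simp: le_floor_iff floor_le_iff)
        then show ?thesis by linarith
      qed
      then show ?thesis by (auto simp: B_def code_def)
    qed
    moreover have "w \<in> F (code w)"
    proof -
      have "\<bar>corner w i - (a i + R / 2 * real_of_int (code w i))\<bar> \<le> R / 2" if "i < D" for i
      proof -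
        define y where "y = (corner w i - a i) / (R / 2)"
        have "corner w i - (a i + R / 2 * real_of_int (code w i)) = R / 2 * (y - real_of_int \<lfloor>y\<rfloor>)"
          using that R by (simp add: code_def y_def field_simps)
        moreover have "0 \<le> y - real_of_int \<lfloor>y\<rfloor>" "y - real_of_int \<lfloor>y\<rfloor> \<le> 1" by linarith+
        ultimately show ?thesis using R mult_left_le[of "y - real_of_int \<lfloor>y\<rfloor>" "R / 2"]
          by (simp only: abs_mult abs_of_nonneg)
      qed
      moreover have "side w \<le> R / 2" 
        unfolding side_def Rh[symmetric] using w by (intro powr_mono) (auto simp: V_def)
      ultimately show ?thesis using w unfolding F_def Rh dome_le_iff V_def by blast
    qed
    ultimately show "w \<in> (\<Union>u\<in>B. F u)" by blast
  qed
  then have "card V \<le> card (\<Union>u\<in>B. F u)" using B(1) W(1) by (intro card_mono) (auto simp: F_def)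
  also have "\<dots> \<le> (\<Sum>u\<in>B. card (F u))" using B(1) by (rule card_UN_le)
  finally have "real (card V) \<le> (\<Sum>u\<in>B. real (card (F u)))" by (simp flip: of_nat_le_iff of_nat_sum)
  also have "\<dots> \<le> (\<Sum>u\<in>B. n / K)" unfolding F_def by (intro sum_mono min)
  also have "\<dots> \<le> 9 ^ D * (n / K)"
    using mult_right_mono[OF B(2), of "n / K"] by (simp add: n_def K_def)
  finally have V: "real (card V) \<le> n / 2" by (simp add: K_def)
  have "{w\<in>W. dome D a w \<le> 2 * R} \<subseteq> V \<union> (T j \<union> T (j + 1))"
  proof
    fix w assume w: "w \<in> {w\<in>W. dome D a w \<le> 2 * R}"
    then have "2 powr real_of_int (fst w) \<le> 2 powr real_of_int (j + 1)"
      unfolding Rd by (simp add: dome_le_iff side_def)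
    then have "fst w \<le> j + 1" by (subst (asm) powr_le_cancel_iff) linarith+
    then have "fst w \<le> j - 1 \<or> fst w = j \<or> fst w = j + 1" by linarith
    then show "w \<in> V \<union> (T j \<union> T (j + 1))" using w W(2) by (auto simp: V_def T_def)
  qed
  then have "card {w\<in>W. dome D a w \<le> 2 * R} \<le> card (V \<union> (T j \<union> T (j + 1)))"
    using W(1) T1 T2 by (intro card_mono) (auto simp: V_def)
  also have "\<dots> \<le> card V + (card (T j) + card (T (j + 1)))"
    by (intro order_trans[OF card_Un_le] add_mono card_Un_le order_refl)
  finally have "real (card {w\<in>W. dome D a w \<le> 2 * R}) \<le> n / 2 + 6 ^ D + 3 ^ D"
    using V T1 T2 by linarith
  \<comment> \<open>By \<open>8 * 6 ^ D \<le> n\<close> the large cells number at most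
    \<open>2 * 6 ^ D \<le> n / 4\<close>.\<close>
  also have "\<dots> \<le> 3 / 4 * n"
    using n6 power_mono[of "3::real" 6 D] by simp
  finally show ?thesis using a unfolding R_def n_def K_def by blast
qed

text \<open>A lies inside the dome of the radius from \<open>thin_shell\<close>, B outside, and S
  consists of the cells whose shell contains that radius. A is bounded by the doubled dome, B
  because it misses the heavy dome of radius R.\<close>

lemma separator:
  assumes W: "finite W" "W \<subseteq> cells D" and n: "8 * 6 ^ D \<le> card W" and D: "1 \<le> D"
    and J: "card W \<le> 2 ^ (J * D)"
  shows "\<exists>S A B. W = S \<union> A \<union> B \<and> S \<inter> A = {} \<and> S \<inter> B = {} \<and> A \<inter> B = {} \<and>
        (\<forall>w\<in>A. \<forall>w'\<in>B. \<not> adj D w w') \<and>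
        real (card S) \<le> 1 + 36 * (3 ^ D * (\<Sum>i<J. 2 ^ (i * (D - 1))) + 2 ^ (J * (D - 1))) \<and>
        real (card A) \<le> (1 - 1 / (2 * 9 ^ D)) * real (card W) \<and>
        real (card B) \<le> (1 - 1 / (2 * 9 ^ D)) * real (card W)"
proof -
  obtain a j where a: "real (card W) / (2 * 9 ^ D) \<le> real (card {w\<in>W. dome D a w \<le> 2 powr real_of_int j})"
    and a2: "real (card {w\<in>W. dome D a w \<le> 2 * 2 powr real_of_int j}) \<le> 3 / 4 * real (card W)"
    using balanced_dome[OF W n] by blast
  define R where "R = 2 powr real_of_int j"
  have R: "0 < R" by (simp add: R_def)
  define V where "V = {w\<in>W. dome D a w \<le> 2 * R}"
  have finV: "finite V" using W by (simp add: V_def)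
  obtain \<mu> where \<mu>: "R \<le> \<mu>" "\<mu> \<le> 2 * R"
    and sh: "real (card {w\<in>W. dome D a w \<le> \<mu> \<and> \<mu> < dome D a w + 18 * side w}) \<le> 1 + 18 / R * (\<Sum>w\<in>V. side w)"
    using thin_shell[OF W(1) R, of 18 side "dome D a"] less_imp_le[OF side_pos] unfolding V_def by auto
  \<comment> \<open>Depth is counted from \<open>j + 1\<close>, the largest scale fitting into
    radius \<open>2 * R\<close>. Thus \<open>side w = 2 * R * (1 / 2) ^ l w\<close>, and 18 / R
    becomes 36.\<close>
  define l where "l w = nat (j + 1 - fst w)" for w :: cell
  have l: "fst w = j + 1 - int (l w)" if "w \<in> V" for w
  proof -
    have "2 powr real_of_int (fst w) \<le> 2 powr real_of_int (j + 1)"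
      using that by (simp add: V_def dome_le_iff side_def R_def powr_add)
    then have "fst w \<le> j + 1" by (subst (asm) powr_le_cancel_iff) linarith+
    then show ?thesis by (simp add: l_def)
  qed
  have p: "2 powr real_of_int (j + 1 - int i) = 2 * R * (1 / 2) ^ i" for i
    by (simp add: powr_diff powr_add R_def powr_realpow power_one_over)
  have "(\<Sum>w\<in>V. side w) = 2 * R * (\<Sum>w\<in>V. (1 / 2) ^ l w)"
    unfolding sum_distrib_left by (intro sum.cong refl) (simp add: side_def l p del: of_int_diff of_int_add)
  then have sh2: "1 + 18 / R * (\<Sum>w\<in>V. side w) = 1 + 36 * (\<Sum>w\<in>V. (1 / 2) ^ l w)"
    using R by simp
  have cnt: "real (card {w\<in>V. l w = i}) \<le> 3 ^ D * 2 ^ (i * D)" for i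
  proof -
    define m where "m = j + 1 - int i"
    have m: "2 powr real_of_int m = 2 * R * (1 / 2) ^ i" unfolding m_def by (rule p)
    have le: "2 powr real_of_int m \<le> 2 * R" unfolding m using R by (simp add: power_le_one)
    have "{w\<in>V. l w = i} \<subseteq> {w\<in>cells D. fst w = m \<and> dome D a w \<le> 2 * R}"
      using l W(2) by (auto simp: V_def m_def)
    then have "card {w\<in>V. l w = i} \<le> card {w\<in>cells D. fst w = m \<and> dome D a w \<le> 2 * R}"
      by (intro card_mono scale_count[OF le])
    then have "real (card {w\<in>V. l w = i}) \<le> (6 * R / 2 powr real_of_int m) ^ D"
      using scale_count(2)[OF le, of D a] by linarith
    also have "6 * R / 2 powr real_of_int m = 3 * 2 ^ i" using R by (simp add: m power_one_over)
    finally show ?thesis by (simp add: power_mult_distrib power_mult)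
  qed
  have cV: "card V \<le> card W" using W by (intro card_mono) (auto simp: V_def)
  have sum: "(\<Sum>w\<in>V. (1 / 2) ^ l w) \<le> 3 ^ D * (\<Sum>i<J. 2 ^ (i * (D - 1))) + (2::real) ^ (J * (D - 1))"
    by (rule scale_sum[OF finV cV _ D cnt J]) simp
  define S where "S = {w\<in>W. dome D a w \<le> \<mu> \<and> \<mu> < dome D a w + 18 * side w}"
  define A where "A = {w\<in>W. dome D a w + 18 * side w \<le> \<mu>}"
  define B where "B = {w\<in>W. \<mu> < dome D a w}"
  have K: "(2::real) \<le> 2 * 9 ^ D" "(9::real) \<le> 9 ^ D" using D power_increasing[of 1 D "9::real"] by simp_all
  have AV: "A \<subseteq> V"
  proof
    fix w assume w: "w \<in> A"
    then have "dome D a w \<le> \<mu>" using side_pos[of w] unfolding A_def mem_Collect_eq by linarith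
    then show "w \<in> V" using w \<mu> by (simp add: A_def V_def)
  qed
  have "real (card A) \<le> real (card V)" using card_mono[OF finV AV] by simp
  also have "\<dots> \<le> 3 / 4 * real (card W)" using a2 by (simp add: V_def R_def)
  \<comment> \<open>Since \<open>1 \<le> D\<close>, the weaker fraction needed for B exceeds 3 /
    4.\<close>
  also have "\<dots> \<le> (1 - 1 / (2 * 9 ^ D)) * real (card W)"
  proof (rule mult_right_mono)
    have "1 / (2 * 9 ^ D) \<le> (1 / 4 :: real)" using K by (simp add: field_simps)
    then show "3 / 4 \<le> (1 - 1 / (2 * 9 ^ D) :: real)" by linarith
  qed simp
  finally have cA: "real (card A) \<le> (1 - 1 / (2 * 9 ^ D)) * real (card W)" .
  have "card B + card {w\<in>W. dome D a w \<le> R} = card (B \<union> {w\<in>W. dome D a w \<le> R})"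
    using W \<mu> by (intro card_Un_disjoint[symmetric]) (auto simp: B_def)
  also have "\<dots> \<le> card W" using W by (intro card_mono) (auto simp: B_def)
  finally have "real (card B) + real (card {w\<in>W. dome D a w \<le> R}) \<le> real (card W)" by linarith
  then have cB: "real (card B) \<le> (1 - 1 / (2 * 9 ^ D)) * real (card W)"
    using a by (simp add: R_def left_diff_distrib)
  have nadj: "\<not> adj D w w'" if "w \<in> A" "w' \<in> B" for w w'
    using dome_adj[of D w w' a] that by (auto simp: A_def B_def)
  have lt: "dome D a w < dome D a w + 18 * side w" for w by simp
  have "A \<inter> B = {}" using less_trans[OF _ lt] by (force simp: A_def B_def)
  moreover have "W = S \<union> A \<union> B" using less_imp_le less_le_trans[OF lt] by (force simp: S_def A_def B_def)
  moreover have "S \<inter> A = {}" "S \<inter> B = {}" by (auto simp: S_def A_def B_def)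
  moreover have "real (card S) \<le> 1 + 36 * (3 ^ D * (\<Sum>i<J. 2 ^ (i * (D - 1))) + 2 ^ (J * (D - 1)))"
    unfolding S_def by (rule order_trans[OF sh[unfolded sh2]], intro add_left_mono mult_left_mono sum) simp
  ultimately show ?thesis using cA cB
    by (intro exI[of _ S] exI[of _ A] exI[of _ B] conjI ballI nadj)
qed

section \<open>Summing the separators over the recursion\<close>

text \<open>\<open>2 ^ J\<close> is the D-th root of n up to a factor 2. The first inequality feeds
  \<open>separator\<close>, the second converts its bound in J into one in n.\<close>

lemma dyadic_threshold:
  fixes n D :: nat
  assumes "1 \<le> n" "1 \<le> D"
  shows "\<exists>J. n \<le> 2 ^ (J * D) \<and> (J = 0 \<or> 2 ^ ((J - 1) * D) \<le> n)"
proof -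
  have ex: "\<exists>J. n \<le> 2 ^ (J * D)"
  proof
    have "n \<le> 2 ^ n" by (simp add: less_imp_le)
    also have "\<dots> \<le> 2 ^ (n * D)" using assms(2) by (intro power_increasing) auto
    finally show "n \<le> 2 ^ (n * D)" .
  qed
  define J where "J = (LEAST J. n \<le> 2 ^ (J * D))"
  have "n \<le> 2 ^ (J * D)" unfolding J_def by (rule LeastI_ex[OF ex])
  moreover have "2 ^ ((J - 1) * D) \<le> n" if "J \<noteq> 0"
    using not_less_Least[of "J - 1" "\<lambda>J. n \<le> 2 ^ (J * D)"] that by (simp add: J_def)
  ultimately show ?thesis by (intro exI[of _ J]) auto
qed

lemma geometric_sum_le:
  fixes x :: real
  assumes "2 \<le> x"
  shows "(\<Sum>i<J. x ^ i) \<le> x ^ J"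
proof (induction J)
  case (Suc J)
  have "2 * x ^ J \<le> x * x ^ J" using assms by (intro mult_right_mono) auto
  then show ?case using Suc by simp
qed simp

text \<open>A separator costs \<open>c * n powr \<alpha>\<close> and sizes shrink by \<beta>, so
  costs along a branch decay geometrically with ratio
  \<open>\<beta> powr \<alpha> < 1\<close>.\<close>

lemma cut_bound_power:
  assumes D: "2 \<le> D"
  shows "\<exists>M>0. \<forall>W. finite W \<longrightarrow> W \<subseteq> cells D \<longrightarrow>
    (\<exists>idx. \<forall>t. real (card (cut_set (adj D) W idx t)) \<le> M * real (card W) powr (1 - 1 / real D))"
proof -
  define \<alpha> where "\<alpha> = 1 - 1 / real D"
  have \<alpha>: "0 < \<alpha>" using D by (simp add: \<alpha>_def)
  define c :: real where "c = (1 + 36 * (3 ^ D + 1)) * 2 ^ (D - 1)"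
  define \<beta> where "\<beta> = (1 - 1 / (2 * 9 ^ D) :: real)"
  have "(1::real) \<le> 9 ^ D" by simp
  then have "(1::real) < 2 * 9 ^ D" by linarith
  then have \<beta>: "0 < \<beta>" "\<beta> < 1" unfolding \<beta>_def by (simp_all add: field_simps)
  then have \<beta>\<alpha>: "\<beta> powr \<alpha> < 1" using \<alpha> powr_less_mono2[of \<alpha> \<beta> 1] by simp
  define n0 :: nat where "n0 = 8 * 6 ^ D"
  have n0: "0 < n0" by (simp add: n0_def)
  \<comment> \<open>The second entry yields \<open>c + M * \<beta> powr \<alpha> \<le> M\<close>,
    which closes the recursion; \<open>n0\<close> covers the sets too small for a separator.\<close>
  define M where "M = max (real n0) (c / (1 - \<beta> powr \<alpha>))"
  have M0: "0 < M" "real n0 \<le> M" using n0 by (simp_all add: M_def less_max_iff_disj)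
  have M1: "c \<le> M * (1 - \<beta> powr \<alpha>)"
  proof -
    have "c = c / (1 - \<beta> powr \<alpha>) * (1 - \<beta> powr \<alpha>)" using \<beta>\<alpha> by simp
    also have "\<dots> \<le> M * (1 - \<beta> powr \<alpha>)" using \<beta>\<alpha> by (intro mult_right_mono) (auto simp: M_def)
    finally show ?thesis .
  qed
  have split: "\<exists>S A B. W = S \<union> A \<union> B \<and> S \<inter> A = {} \<and> S \<inter> B = {} \<and> A \<inter> B = {} \<and>
        (\<forall>w\<in>A. \<forall>w'\<in>B. \<not> adj D w w') \<and> real (card S) \<le> c * real (card W) powr \<alpha> \<and>
        real (card A) \<le> \<beta> * real (card W) \<and> real (card B) \<le> \<beta> * real (card W)"
    if W: "finite W" "W \<subseteq> cells D" "n0 \<le> card W" for W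
  proof -
    define n where "n = card W"
    have n1: "1 \<le> n" using W n0 by (simp add: n_def)
    obtain J where J: "n \<le> 2 ^ (J * D)" "J = 0 \<or> 2 ^ ((J - 1) * D) \<le> n"
      using dyadic_threshold[OF n1, of D] D by auto
    have na: "1 \<le> real n powr \<alpha>" using n1 \<alpha> by (simp add: ge_one_powr_ge_zero)
    \<comment> \<open>Raise \<open>2 ^ ((J - 1) * D) \<le> n\<close> to the power \<alpha>, using
      \<open>D * \<alpha> = D - 1\<close>; passing from J - 1 to J costs
      \<open>2 ^ (D - 1)\<close>.\<close>
    have top: "2 ^ (J * (D - 1)) \<le> 2 ^ (D - 1) * real n powr \<alpha>"
    proof (cases "J = 0")
      case True
      have "1 * 1 \<le> 2 ^ (D - 1) * real n powr \<alpha>" using na by (intro mult_mono) auto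
      then show ?thesis using True by simp
    next
      case False
      define k where "k = J - 1"
      have Jk: "J = Suc k" using False by (simp add: k_def)
      have "real (2 ^ (k * D)) \<le> real n" using J(2) False unfolding k_def of_nat_le_iff by simp
      then have "2 powr real (k * D) \<le> real n" by (subst powr_realpow) simp_all
      then have "(2 powr real (k * D)) powr \<alpha> \<le> real n powr \<alpha>"
        using \<alpha> by (intro powr_mono2) auto
      also have "(2 powr real (k * D)) powr \<alpha> = 2 powr real (k * (D - 1))"
      proof -
        have "real D * \<alpha> = real (D - 1)" using D by (simp add: \<alpha>_def right_diff_distrib of_nat_diff)
        then show ?thesis by (simp only: powr_powr of_nat_mult mult.assoc)
      qed
      also have "\<dots> = 2 ^ (k * (D - 1))" by (rule powr_realpow) simp
      finally show ?thesis unfolding Jk by (simp add: power_add)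
    qed
    have geo: "(\<Sum>i<J. 2 ^ (i * (D - 1))) \<le> (2::real) ^ (J * (D - 1))"
    proof -
      \<comment> \<open>Here \<open>2 \<le> D\<close> enters: the last scale dominates the
        sum.\<close>
      have "(2::real) \<le> 2 ^ (D - 1)" using D power_increasing[of 1 "D - 1" "2::real"] by simp
      then have "(\<Sum>i<J. (2 ^ (D - 1)) ^ i) \<le> ((2::real) ^ (D - 1)) ^ J" by (rule geometric_sum_le)
      then show ?thesis by (simp only: power_mult[symmetric] mult.commute[of "D - 1"])
    qed
    have "1 + 36 * (3 ^ D * (\<Sum>i<J. 2 ^ (i * (D - 1))) + 2 ^ (J * (D - 1)))
        \<le> 1 + 36 * (3 ^ D * 2 ^ (J * (D - 1)) + (2::real) ^ (J * (D - 1)))"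
      using geo by (intro add_mono mult_left_mono) auto
    also have "\<dots> = 1 + 36 * (3 ^ D + 1) * (2::real) ^ (J * (D - 1))" by (simp add: algebra_simps)
    also have "\<dots> \<le> (1 + 36 * (3 ^ D + 1)) * (2::real) ^ (J * (D - 1))" by (simp add: distrib_right)
    also have "\<dots> \<le> (1 + 36 * (3 ^ D + 1)) * (2 ^ (D - 1) * real n powr \<alpha>)"
      using top by (intro mult_left_mono) auto
    also have "\<dots> = c * real n powr \<alpha>" by (simp add: c_def)
    finally have le: "1 + 36 * (3 ^ D * (\<Sum>i<J. 2 ^ (i * (D - 1))) + 2 ^ (J * (D - 1))) \<le> c * real n powr \<alpha>" .
    have D1: "1 \<le> D" using D by simp
    obtain S A B where SAB: "W = S \<union> A \<union> B" "S \<inter> A = {}" "S \<inter> B = {}" "A \<inter> B = {}"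
        "\<forall>w\<in>A. \<forall>w'\<in>B. \<not> adj D w w'"
      and cS: "real (card S) \<le> 1 + 36 * (3 ^ D * (\<Sum>i<J. 2 ^ (i * (D - 1))) + 2 ^ (J * (D - 1)))"
      and cAB: "real (card A) \<le> \<beta> * real (card W)" "real (card B) \<le> \<beta> * real (card W)"
      using separator[OF W(1,2) W(3)[unfolded n0_def] D1 J(1)[unfolded n_def]] unfolding \<beta>_def[symmetric] by (elim exE conjE)
    from SAB order_trans[OF cS le[unfolded n_def]] cAB show ?thesis
      by (intro exI[of _ S] exI[of _ A] exI[of _ B] conjI)
  qed
  have small: "real n \<le> M * real n powr \<alpha>" if "n < n0" for n
  proof (cases "n = 0")
    case False
    then have "1 \<le> real n powr \<alpha>" using \<alpha> by (simp add: ge_one_powr_ge_zero)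
    then have "real n * 1 \<le> M * real n powr \<alpha>" using that M0 by (intro mult_mono) auto
    then show ?thesis by simp
  qed simp
  have step: "c * real n powr \<alpha> + M * real m powr \<alpha> \<le> M * real n powr \<alpha>"
    if "n0 \<le> n" "real m \<le> \<beta> * real n" for m n
  proof -
    have "real m powr \<alpha> \<le> (\<beta> * real n) powr \<alpha>" using that \<alpha> by (intro powr_mono2) auto
    also have "\<dots> = \<beta> powr \<alpha> * real n powr \<alpha>" using \<beta> by (simp add: powr_mult)
    finally have "M * real m powr \<alpha> \<le> M * (\<beta> powr \<alpha> * real n powr \<alpha>)" using M0 by simp
    moreover have "c * real n powr \<alpha> \<le> M * (1 - \<beta> powr \<alpha>) * real n powr \<alpha>"
      by (rule mult_right_mono[OF M1]) simp
    ultimately show ?thesis by (simp add: algebra_simps)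
  qed
  have "\<exists>idx. \<forall>t. real (card (cut_set (adj D) W idx t)) \<le> M * real (card W) powr \<alpha>"
    if "finite W" "W \<subseteq> cells D" for W
    by (rule cut_recursion[where s = "\<lambda>n. c * real n powr \<alpha>" and H = "\<lambda>n. M * real n powr \<alpha>",
          OF split \<beta>(2) n0 small step that])
  then show ?thesis using M0(1) unfolding \<alpha>_def by blast
qed

text \<open>A separator costs a multiple of \<open>L n\<close>, while \<open>L\<close> drops by at
  least b per level. The square pays for this, as
  \<open>(L n)^2 - (L n - b)^2 \<ge> b * L n\<close>.\<close>

lemma cut_bound_log:
  "\<exists>M>0. \<forall>W. finite W \<longrightarrow> W \<subseteq> cells 1 \<longrightarrow>
    (\<exists>idx. \<forall>t. real (card (cut_set (adj 1) W idx t)) \<le> M * (1 + ln (1 + real (card W)))\<^sup>2)"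
proof -
  define L where "L n = 1 + ln (1 + real n)" for n
  have L1: "1 \<le> L n" for n by (simp add: L_def)
  \<comment> \<open>For \<open>n \<ge> 1\<close> and \<open>m \<le> 17 / 18 * n\<close> one has
    \<open>1 + m \<le> 35 / 36 * (1 + n)\<close>.\<close>
  define b where "b = ln (36 / 35 :: real)"
  have b: "0 < b" by (simp add: b_def)
  define \<beta> where "\<beta> = (17 / 18 :: real)"
  have \<beta>: "\<beta> < 1" by (simp add: \<beta>_def)
  define n0 :: nat where "n0 = 48"
  have n0: "0 < n0" by (simp add: n0_def)
  define M where "M = max (real n0) (216 / b)"
  have M0: "0 < M" "real n0 \<le> M" using n0 by (simp_all add: M_def less_max_iff_disj)
  have M1: "216 \<le> M * b"
  proof -
    have "216 = 216 / b * b" using b by simp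
    also have "\<dots> \<le> M * b" using b by (intro mult_right_mono) (auto simp: M_def)
    finally show ?thesis .
  qed
  have split: "\<exists>S A B. W = S \<union> A \<union> B \<and> S \<inter> A = {} \<and> S \<inter> B = {} \<and> A \<inter> B = {} \<and>
        (\<forall>w\<in>A. \<forall>w'\<in>B. \<not> adj 1 w w') \<and> real (card S) \<le> 216 * L (card W) \<and>
        real (card A) \<le> \<beta> * real (card W) \<and> real (card B) \<le> \<beta> * real (card W)"
    if W: "finite W" "W \<subseteq> cells 1" "n0 \<le> card W" for W
  proof -
    define n where "n = card W"
    have n1: "1 \<le> n" using W n0 by (simp add: n_def)
    obtain J where J: "n \<le> 2 ^ (J * 1)" "J = 0 \<or> 2 ^ ((J - 1) * 1) \<le> n"
      using dyadic_threshold[OF n1, of 1] by auto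
    have ln0: "0 \<le> ln (1 + real n)" by simp
    have top: "real J \<le> 1 + 2 * ln (1 + real n)"
    proof (cases "J = 0")
      case False
      then have "real (2 ^ (J - 1)) \<le> real n" using J(2) unfolding of_nat_le_iff by simp
      then have "2 ^ (J - 1) \<le> 1 + real n" unfolding of_nat_power of_nat_numeral by linarith
      then have "ln (2 ^ (J - 1)) \<le> ln (1 + real n)" by (subst ln_le_cancel_iff) auto
      then have "real (J - 1) * ln 2 \<le> ln (1 + real n)" by (simp add: ln_realpow)
      moreover have "real (J - 1) * (1 / 2) \<le> real (J - 1) * ln 2"
        using ln2_ge_two_thirds by (intro mult_left_mono) auto
      ultimately show ?thesis using False by (simp add: of_nat_diff)
    qed (use ln0 in auto)
    \<comment> \<open>For \<open>D = 1\<close> every scale contributes 1, so the left side is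
      \<open>37 + 108 * J\<close>.\<close>
    have le: "1 + 36 * (3 ^ 1 * (\<Sum>i<J. 2 ^ (i * (1 - 1))) + 2 ^ (J * (1 - 1))) \<le> 216 * L n"
      using top ln0 by (simp add: L_def)
    have \<beta>': "\<beta> = 1 - 1 / (2 * 9 ^ 1)" by (simp add: \<beta>_def)
    have n8: "8 * 6 ^ 1 \<le> card W" using W(3) by (simp add: n0_def)
    obtain S A B where SAB: "W = S \<union> A \<union> B" "S \<inter> A = {}" "S \<inter> B = {}" "A \<inter> B = {}"
        "\<forall>w\<in>A. \<forall>w'\<in>B. \<not> adj 1 w w'"
      and cS: "real (card S) \<le> 1 + 36 * (3 ^ 1 * (\<Sum>i<J. 2 ^ (i * (1 - 1))) + 2 ^ (J * (1 - 1)))"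
      and cAB: "real (card A) \<le> \<beta> * real (card W)" "real (card B) \<le> \<beta> * real (card W)"
      using separator[OF W(1,2) n8 order_refl J(1)[unfolded n_def]] unfolding \<beta>'[symmetric] by (elim exE conjE)
    from SAB order_trans[OF cS le[unfolded n_def]] cAB show ?thesis
      by (intro exI[of _ S] exI[of _ A] exI[of _ B] conjI)
  qed
  have small: "real n \<le> M * (L n)\<^sup>2" if "n < n0" for n
  proof -
    have "1 \<le> (L n)\<^sup>2" using L1 by (simp add: one_le_power)
    then have "real n * 1 \<le> M * (L n)\<^sup>2" using that M0 by (intro mult_mono) auto
    then show ?thesis by simp
  qed
  have step: "216 * L n + M * (L m)\<^sup>2 \<le> M * (L n)\<^sup>2"
    if "n0 \<le> n" "real m \<le> \<beta> * real n" for m n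
  proof -
    have "1 \<le> real n" using that(1) n0 by linarith
    then have "1 + real m \<le> 35 / 36 * (1 + real n)" using that(2) by (simp add: \<beta>_def)
    then have "ln (1 + real m) \<le> ln (35 / 36 * (1 + real n))" by (subst ln_le_cancel_iff) auto
    also have "\<dots> = ln (1 + real n) - b"
      by (subst ln_mult) (simp_all add: b_def ln_div)
    finally have Lm: "L m \<le> L n - b" by (simp add: L_def)
    then have Lb: "0 \<le> L n - b" using L1[of m] by linarith
    have "(L m)\<^sup>2 \<le> (L n - b)\<^sup>2" using Lm L1[of m] by (intro power_mono) auto
    also have "\<dots> = (L n)\<^sup>2 - b * L n - b * (L n - b)" by (simp add: power2_eq_square algebra_simps)
    also have "\<dots> \<le> (L n)\<^sup>2 - b * L n" using b Lb by simp
    finally have "M * (L m)\<^sup>2 \<le> M * ((L n)\<^sup>2 - b * L n)" using M0 by (intro mult_left_mono) auto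
    moreover have "216 * L n \<le> M * b * L n" using M1 L1[of n] by (intro mult_right_mono) auto
    ultimately show ?thesis by (simp add: algebra_simps)
  qed
  have "\<exists>idx. \<forall>t. real (card (cut_set (adj 1) W idx t)) \<le> M * (L (card W))\<^sup>2"
    if "finite W" "W \<subseteq> cells 1" for W
    by (rule cut_recursion[where s = "\<lambda>n. 216 * L n" and H = "\<lambda>n. M * (L n)\<^sup>2",
          OF split \<beta> n0 small step that])
  then show ?thesis using M0(1) unfolding L_def by blast
qed

section \<open>Geometry of the half-space model\<close>

text \<open>This is \<open>cosh (hdist d x y) - 1\<close>, which turns distance estimates into
  algebraic ones.\<close>

definition hsq :: "nat \<Rightarrow> (nat \<Rightarrow> real) \<Rightarrow> (nat \<Rightarrow> real) \<Rightarrow> real" where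
  "hsq d x y = (\<Sum>i<d. (x i - y i)\<^sup>2) / (2 * x (d - 1) * y (d - 1))"

lemma cosh_hdist:
  assumes "x \<in> hyp d" "y \<in> hyp d"
  shows "cosh (hdist d x y) = 1 + hsq d x y" "0 \<le> hdist d x y" "0 \<le> hsq d x y"
proof -
  show h: "0 \<le> hsq d x y" using assms by (auto simp: hsq_def hyp_def intro!: divide_nonneg_pos sum_nonneg)
  show "cosh (hdist d x y) = 1 + hsq d x y" "0 \<le> hdist d x y"
    using h unfolding hdist_def hsq_def[symmetric] by simp_all
qed

text \<open>Crude bounds are enough: distance at most 1 forces \<open>hsq \<le> 1\<close>, and
  \<open>hsq \<le> 1 / 4\<close> forces distance at most 1.\<close>

lemma cosh_one_bounds: "5 / 4 \<le> cosh (1::real)" "cosh (1::real) \<le> 2"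
proof -
  have e: "exp (1::real) \<le> 3" "exp (- 1 :: real) \<le> 1" "(5 / 2 :: real) \<le> exp 1" "(0::real) \<le> exp (-1)"
    using exp_le exp_lower_Taylor_quadratic[of 1] by simp_all
  show "5 / 4 \<le> cosh (1::real)" using e(3,4) unfolding cosh_field_def by argo
  show "cosh (1::real) \<le> 2" using e(1,2) unfolding cosh_field_def by argo
qed

lemma coord_le_hsq:
  assumes "x \<in> hyp d" "y \<in> hyp d" "i < d"
  shows "(x i - y i)\<^sup>2 \<le> 2 * x (d - 1) * y (d - 1) * hsq d x y"
proof -
  have "(x i - y i)\<^sup>2 \<le> (\<Sum>i<d. (x i - y i)\<^sup>2)" using assms(3) by (intro member_le_sum) auto
  also have "\<dots> = 2 * x (d - 1) * y (d - 1) * hsq d x y" using assms by (simp add: hsq_def hyp_def)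
  finally show ?thesis .
qed

text \<open>The last coordinate alone gives \<open>(a - b)^2 \<le> 2 * a * b\<close>, that is
  \<open>a^2 + b^2 \<le> 4 * a * b\<close>; dropping either square bounds one height by 4 times the
  other.\<close>

lemma height_ratio:
  assumes xy: "x \<in> hyp d" "y \<in> hyp d" "0 < d" and h: "hsq d x y \<le> 1"
  shows "y (d - 1) \<le> 4 * x (d - 1)" "x (d - 1) \<le> 4 * y (d - 1)"
proof -
  define a b where "a = x (d - 1)" and "b = y (d - 1)"
  have ab: "0 < a" "0 < b" using xy by (auto simp: a_def b_def hyp_def)
  have "(a - b)\<^sup>2 \<le> 2 * a * b * hsq d x y" using coord_le_hsq[OF xy(1,2), of "d - 1"] xy(3) by (simp add: a_def b_def)
  also have "\<dots> \<le> 2 * a * b * 1" using ab h by (intro mult_left_mono) auto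
  finally have e: "a\<^sup>2 + b\<^sup>2 \<le> 4 * a * b" by (simp add: power2_diff)
  have "b * b \<le> (4 * a) * b" using e zero_le_power2[of a] unfolding power2_eq_square by linarith
  then show "y (d - 1) \<le> 4 * x (d - 1)" using ab by (simp add: a_def b_def)
  have "a * a \<le> (4 * b) * a" using e zero_le_power2[of b] unfolding power2_eq_square by argo
  then show "x (d - 1) \<le> 4 * y (d - 1)" using ab by (simp add: a_def b_def)
qed

lemma hdist_le_1D:
  assumes xy: "x \<in> hyp d" "y \<in> hyp d" "0 < d" and h: "hdist d x y \<le> 1"
  shows "hsq d x y \<le> 1" and "i < d \<Longrightarrow> \<bar>x i - y i\<bar> \<le> 3 * x (d - 1)"
proof -
  have "cosh (hdist d x y) \<le> cosh 1"
    using h cosh_hdist(2)[OF xy(1,2)] by (subst cosh_real_nonneg_le_iff) auto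
  then show h1: "hsq d x y \<le> 1" using cosh_hdist(1)[OF xy(1,2)] cosh_one_bounds(2) by linarith
  define a where "a = x (d - 1)"
  have a: "0 < a" "0 < y (d - 1)" using xy by (auto simp: a_def hyp_def)
  assume "i < d"
  then have "(x i - y i)\<^sup>2 \<le> 2 * a * y (d - 1) * hsq d x y" using coord_le_hsq[OF xy(1,2)] by (simp add: a_def)
  also have "\<dots> \<le> 2 * a * (4 * a) * 1"
    using height_ratio(1)[OF xy h1] a h1 cosh_hdist(3)[OF xy(1,2)] by (intro mult_mono) (auto simp: a_def)
  also have "\<dots> \<le> (3 * a)\<^sup>2" by (simp add: power2_eq_square)
  finally show "\<bar>x i - y i\<bar> \<le> 3 * x (d - 1)" using a abs_le_square_iff[of "x i - y i" "3 * a"] by (simp add: a_def)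
qed

lemma hdist_le_1I:
  assumes xy: "x \<in> hyp d" "y \<in> hyp d" and h: "(\<Sum>i<d. (x i - y i)\<^sup>2) \<le> x (d - 1) * y (d - 1) / 2"
  shows "hdist d x y \<le> 1"
proof -
  have "0 < x (d - 1) * y (d - 1)" using xy by (simp add: hyp_def)
  then have "hsq d x y \<le> 1 / 4" using h by (simp add: hsq_def field_simps)
  then have "cosh (hdist d x y) \<le> cosh 1" using cosh_hdist(1)[OF xy] cosh_one_bounds(1) by linarith
  then show ?thesis using cosh_hdist(2)[OF xy] by (subst (asm) cosh_real_nonneg_le_iff) auto
qed

section \<open>Limits in the hyperbolic metric\<close>

text \<open>The neighbourhoods of z in Z for \<open>hdist\<close>, as a filter, so that the
  epsilon-delta condition in \<open>cont_into\<close> follows from rules for limits.\<close>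

definition hfilter :: "nat \<Rightarrow> (nat \<Rightarrow> real) set \<Rightarrow> (nat \<Rightarrow> real) \<Rightarrow> (nat \<Rightarrow> real) filter" where
  "hfilter d Z z = inf (filtercomap (hdist d z) (nhds 0)) (principal Z)"

lemma eventually_hfilterD:
  assumes "eventually P (hfilter d Z z)" and "Z \<subseteq> hyp d" "z \<in> Z"
  shows "\<exists>\<delta>>0. \<forall>w\<in>Z. hdist d z w < \<delta> \<longrightarrow> P w"
proof -
  obtain Q where Q: "eventually Q (nhds (0::real))" "\<And>w. Q (hdist d z w) \<Longrightarrow> w \<in> Z \<Longrightarrow> P w"
    using assms(1) by (auto simp: hfilter_def eventually_inf_principal eventually_filtercomap)
  obtain \<delta> where \<delta>: "\<delta> > 0" "\<And>y. dist y 0 < \<delta> \<Longrightarrow> Q y"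
    using Q(1) by (auto simp: eventually_nhds_metric)
  have "P w" if "w \<in> Z" "hdist d z w < \<delta>" for w
  proof -
    have "0 \<le> hdist d z w" using cosh_hdist(2)[of z d w] assms(2,3) that by auto
    then show ?thesis using \<delta>(2) Q(2) that by simp
  qed
  then show ?thesis using \<delta>(1) by blast
qed

text \<open>\<open>hsq\<close> tends to 0 by continuity of \<open>cosh\<close>. Once it is below 1
  the heights are comparable, and it controls the coordinate difference.\<close>

lemma tendsto_coord_hfilter:
  assumes Z: "Z \<subseteq> hyp d" "z \<in> Z" and i: "i < d"
  shows "((\<lambda>w. w i) \<longlongrightarrow> z i) (hfilter d Z z)"
proof -
  let ?F = "hfilter d Z z"
  have evZ: "eventually (\<lambda>w. w \<in> Z) ?F" by (simp add: hfilter_def eventually_inf_principal)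
  have "filterlim (hdist d z) (nhds 0) ?F"
    unfolding hfilter_def by (rule filterlim_mono[OF filterlim_filtercomap order_refl inf_le1])
  then have "((\<lambda>w. cosh (hdist d z w) - 1) \<longlongrightarrow> cosh 0 - 1) ?F" by (intro tendsto_intros)
  then have "((\<lambda>w. cosh (hdist d z w) - 1) \<longlongrightarrow> 0) ?F" by simp
  moreover have "\<forall>\<^sub>F w in ?F. cosh (hdist d z w) - 1 = hsq d z w"
    using evZ
  proof eventually_elim
    case (elim w)
    then show ?case using cosh_hdist(1)[OF subsetD[OF Z] subsetD[OF Z(1) elim]] by simp
  qed
  ultimately have h0: "(hsq d z \<longlongrightarrow> 0) ?F" by (rule Lim_transform_eventually)
  define a where "a = z (d - 1)"
  have a: "0 < a" using Z by (auto simp: a_def hyp_def)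
  have "eventually (\<lambda>w. hsq d z w < 1) ?F" using h0 by (rule order_tendstoD) simp
  then have le: "\<forall>\<^sub>F w in ?F. \<bar>w i - z i\<bar> \<le> sqrt (8 * a\<^sup>2 * hsq d z w)"
    using evZ
  proof eventually_elim
    case (elim w)
    then have w: "z \<in> hyp d" "w \<in> hyp d" "0 < d" using Z i by auto
    have "(z i - w i)\<^sup>2 \<le> 2 * a * w (d - 1) * hsq d z w" using coord_le_hsq[OF w(1,2) i] by (simp add: a_def)
    also have "\<dots> \<le> 2 * a * (4 * a) * hsq d z w"
      using height_ratio(1)[OF w] elim a cosh_hdist(3)[OF w(1,2)]
      by (intro mult_right_mono mult_left_mono) (auto simp: a_def)
    also have "\<dots> = 8 * a\<^sup>2 * hsq d z w" by (simp add: power2_eq_square)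
    finally have "sqrt ((z i - w i)\<^sup>2) \<le> sqrt (8 * a\<^sup>2 * hsq d z w)" by (rule real_sqrt_le_mono)
    then show ?case by (simp add: abs_minus_commute)
  qed
  have "((\<lambda>w. sqrt (8 * a\<^sup>2 * hsq d z w)) \<longlongrightarrow> sqrt (8 * a\<^sup>2 * 0)) ?F"
    by (intro tendsto_intros h0)
  then have "((\<lambda>w. sqrt (8 * a\<^sup>2 * hsq d z w)) \<longlongrightarrow> 0) ?F" by (simp only: mult_zero_right real_sqrt_zero)
  with le have "((\<lambda>w. w i - z i) \<longlongrightarrow> 0) ?F"
    unfolding real_norm_def[symmetric] by (rule Lim_null_comparison)
  then show ?thesis by (simp add: LIM_zero_iff)
qed

text \<open>A cell only records the \<open>D\<close> horizontal coordinates \<open>k, \<dots>, k + D - 1\<close> and the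
  height, which is coordinate \<open>k + D\<close>.\<close>

definition cell_of :: "nat \<Rightarrow> nat \<Rightarrow> (nat \<Rightarrow> real) \<Rightarrow> cell" where
  "cell_of k D x = (let m = \<lfloor>log 2 (x (k + D))\<rfloor> in
     (m, restrict (\<lambda>i. \<lfloor>x (k + i) / 2 powr real_of_int m\<rfloor>) {..<D}))"

lemma cell_of_in_cells: "cell_of k D x \<in> cells D"
  by (simp add: cell_of_def cells_def Let_def)

lemma side_cell_of:
  assumes "0 < x (k + D)"
  shows "side (cell_of k D x) \<le> x (k + D)" "x (k + D) < 2 * side (cell_of k D x)"
proof -
  define t where "t = log 2 (x (k + D))"
  have x: "x (k + D) = 2 powr t" using assms by (simp add: t_def)
  have s: "side (cell_of k D x) = 2 powr real_of_int \<lfloor>t\<rfloor>" by (simp add: side_def cell_of_def Let_def t_def)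
  show "side (cell_of k D x) \<le> x (k + D)" unfolding x s by (intro powr_mono) auto
  have "2 powr t < 2 powr (real_of_int \<lfloor>t\<rfloor> + 1)" by (intro powr_less_mono) linarith+
  then show "x (k + D) < 2 * side (cell_of k D x)" unfolding x s by (simp add: powr_add)
qed

lemma snd_cell_of:
  assumes "i < D"
  shows "snd (cell_of k D x) i = \<lfloor>x (k + i) / side (cell_of k D x)\<rfloor>"
  using assms by (simp add: cell_of_def Let_def side_def)

text \<open>Heights in the ball are within a factor 4 of that of c, which leaves 5 scales.
  Horizontally \<open>3 * c (k + D) \<le> 12 * x (k + D) < 24 * side w\<close>, and rounding adds 1,
  so each coordinate has at most \<open>2 * 25 + 1\<close> values.\<close>

lemma cells_meeting_ball:
  assumes c: "c \<in> hyp (k + D + 1)"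
  shows "finite (cell_of k D ` {x \<in> hyp (k + D + 1). hdist (k + D + 1) c x \<le> 1})" (is "finite ?A")
    and "card (cell_of k D ` {x \<in> hyp (k + D + 1). hdist (k + D + 1) c x \<le> 1}) \<le> 5 * 51 ^ D"
proof -
  let ?d = "k + D + 1"
  define m0 where "m0 = \<lfloor>log 2 (c (k + D))\<rfloor>"
  define B where "B m = {v \<in> extensional {..<D}. \<forall>i<D. \<bar>real_of_int (v i) - c (k + i) / 2 powr real_of_int m\<bar> \<le> 25}" for m :: int
  have B: "finite (B m)" "real (card (B m)) \<le> 51 ^ D" for m
    unfolding B_def using int_box_card[of 25 D "\<lambda>i. c (k + i) / 2 powr real_of_int m"] by auto
  have sub: "?A \<subseteq> Sigma {m0 - 2..m0 + 2} B"
  proof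
    fix w assume "w \<in> ?A"
    then obtain x where x: "x \<in> hyp ?d" "hdist ?d c x \<le> 1" and w: "w = cell_of k D x" by auto
    have pos: "0 < c (k + D)" "0 < x (k + D)" using c x by (auto simp: hyp_def)
    have h1: "hsq ?d c x \<le> 1" using hdist_le_1D(1)[OF c x(1) _ x(2)] by simp
    have r: "x (k + D) \<le> 4 * c (k + D)" "c (k + D) \<le> 4 * x (k + D)"
      using height_ratio[OF c x(1) _ h1] by simp_all
    have m: "fst w = \<lfloor>log 2 (x (k + D))\<rfloor>" by (simp add: w cell_of_def Let_def)
    have log4: "log 2 (4 * y) = 2 + log 2 y" if "0 < y" for y :: real
      using that log_pow_cancel[of 2 2] by (simp add: log_mult)
    have "log 2 (x (k + D)) \<le> 2 + log 2 (c (k + D))" "log 2 (c (k + D)) \<le> 2 + log 2 (x (k + D))"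
      unfolding log4[OF pos(1), symmetric] log4[OF pos(2), symmetric] using r pos by simp_all
    then have fw: "fst w \<in> {m0 - 2..m0 + 2}" unfolding m m0_def atLeastAtMost_iff by linarith
    define s where "s = side w"
    have s: "0 < s" "x (k + D) < 2 * s" using side_cell_of[of x k D] pos by (simp_all add: s_def w)
    have "\<bar>real_of_int (snd w i) - c (k + i) / s\<bar> \<le> 25" if "i < D" for i
    proof -
      have "\<bar>c (k + i) - x (k + i)\<bar> \<le> 3 * c (k + D)"
        using hdist_le_1D(2)[OF c x(1) _ x(2), of "k + i"] that by simp
      then have "\<bar>x (k + i) - c (k + i)\<bar> \<le> 24 * s" using r s by linarith
      then have "\<bar>(x (k + i) - c (k + i)) / s\<bar> \<le> 24" using s by (simp add: abs_divide field_simps)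
      then have "\<bar>x (k + i) / s - c (k + i) / s\<bar> \<le> 24" by (simp add: diff_divide_distrib)
      moreover have "snd w i = \<lfloor>x (k + i) / s\<rfloor>" using snd_cell_of[OF that] by (simp add: w s_def)
      ultimately show ?thesis by linarith
    qed
    then have "snd w \<in> B (fst w)"
      using cell_of_in_cells[of k D x] by (auto simp: B_def s_def side_def w cells_def mem_Times_iff)
    then show "w \<in> Sigma {m0 - 2..m0 + 2} B" using fw by (cases w) simp
  qed
  have fin: "finite (Sigma {m0 - 2..m0 + 2} B)" using B by auto
  show "finite ?A" using sub fin by (rule finite_subset)
  have "real (card ?A) \<le> real (card (Sigma {m0 - 2..m0 + 2} B))" using card_mono[OF fin sub] by simp
  also have "\<dots> = (\<Sum>m\<in>{m0 - 2..m0 + 2}. real (card (B m)))" using B by (simp add: card_SigmaI)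
  also have "\<dots> \<le> (\<Sum>m\<in>{m0 - 2..m0 + 2}. 51 ^ D)" by (intro sum_mono B)
  also have "\<dots> = real (5 * 51 ^ D)" by simp
  finally show "card ?A \<le> 5 * 51 ^ D" by (simp only: of_nat_le_iff)
qed

section \<open>Bump functions of the cells\<close>

text \<open>An unnormalised partition of unity: a product of continuous factors, positive on the
  cell itself and vanishing outside an enlargement of comparable size.\<close>

definition bump :: "nat \<Rightarrow> nat \<Rightarrow> cell \<Rightarrow> (nat \<Rightarrow> real) \<Rightarrow> real" where
  "bump k D w x = (\<Prod>i<D. max 0 (2 - \<bar>x (k + i) / side w - real_of_int (snd w i)\<bar>)) *
     max 0 (x (k + D) - side w / 2) * max 0 (4 * side w - x (k + D))"

lemma bump_nonneg: "0 \<le> bump k D w x"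
  unfolding bump_def by (intro mult_nonneg_nonneg prod_nonneg) auto

lemma bump_posD:
  assumes "0 < bump k D w x"
  shows "i < D \<Longrightarrow> \<bar>x (k + i) - corner w i\<bar> < 2 * side w"
    and "side w / 2 < x (k + D)" and "x (k + D) < 4 * side w"
proof -
  have nz: "bump k D w x \<noteq> 0" using assms by simp
  then show "side w / 2 < x (k + D)" "x (k + D) < 4 * side w" by (auto simp: bump_def max_def split: if_splits)
  assume i: "i < D"
  have "max 0 (2 - \<bar>x (k + i) / side w - real_of_int (snd w i)\<bar>) \<noteq> 0" using nz i by (auto simp: bump_def)
  then have "\<bar>x (k + i) / side w - real_of_int (snd w i)\<bar> < 2" by (auto simp: max_def split: if_splits)
  then have "side w * \<bar>x (k + i) / side w - real_of_int (snd w i)\<bar> < side w * 2" by (intro mult_strict_left_mono) auto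
  moreover have "side w * \<bar>x (k + i) / side w - real_of_int (snd w i)\<bar> = \<bar>x (k + i) - corner w i\<bar>"
    by (simp add: corner_def right_diff_distrib abs_mult_pos' less_imp_le)
  ultimately show "\<bar>x (k + i) - corner w i\<bar> < 2 * side w" by (simp add: mult.commute)
qed

lemma bump_cell_of_pos:
  assumes "0 < x (k + D)"
  shows "0 < bump k D (cell_of k D x) x"
proof -
  let ?w = "cell_of k D x"
  have "side ?w \<le> x (k + D)" "x (k + D) < 2 * side ?w" "0 < side ?w" using side_cell_of[of x k D, OF assms] by simp_all
  moreover have "0 < (\<Prod>i<D. max 0 (2 - \<bar>x (k + i) / side ?w - real_of_int (snd ?w i)\<bar>))"
  proof (rule prod_pos)
    fix i assume "i \<in> {..<D}"
    then have v: "snd ?w i = \<lfloor>x (k + i) / side ?w\<rfloor>" by (simp add: snd_cell_of)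
    have "\<bar>x (k + i) / side ?w - real_of_int (snd ?w i)\<bar> < 2" unfolding v by linarith
    then show "0 < max 0 (2 - \<bar>x (k + i) / side ?w - real_of_int (snd ?w i)\<bar>)" by simp
  qed
  ultimately show ?thesis unfolding bump_def by (intro mult_pos_pos) auto
qed

text \<open>The constants of \<open>adj\<close> come from here: a common point is lower than
  \<open>4 * side w\<close> and higher than \<open>side w' / 2\<close>, whence 8, and the corners
  are less than \<open>2 * side w + 2 * side w'\<close> apart, whence 18.\<close>

lemma bump_adj:
  assumes "0 < bump k D w x" "0 < bump k D w' x"
  shows "adj D w w'"
proof -
  note a = bump_posD[OF assms(1)] and b = bump_posD[OF assms(2)]
  have s: "side w' \<le> 8 * side w" using a(3) b(2) by linarith
  have "\<bar>corner w' i - corner w i\<bar> \<le> 18 * side w" if "i < D" for i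
    using a(1)[OF that] b(1)[OF that] s by linarith
  then show ?thesis using s by (simp add: adj_def)
qed

lemma tendsto_bump:
  assumes "Z \<subseteq> hyp (k + D + 1)" "z \<in> Z"
  shows "(bump k D w \<longlongrightarrow> bump k D w z) (hfilter (k + D + 1) Z z)"
  unfolding bump_def[abs_def]
  by (intro tendsto_mult tendsto_prod tendsto_max tendsto_diff tendsto_rabs tendsto_divide tendsto_const
      tendsto_coord_hfilter[OF assms]) simp_all

section \<open>Fibres of the averaged numbering\<close>

text \<open>If every positively weighted value exceeded the mean t, the sum of
  \<open>p w * (f w - t)\<close> would be positive, yet it vanishes. The conclusion
  \<open>0 < p w\<close> later places a point in the support of the bump of
  \<open>w\<close>.\<close>

lemma weighted_mean_ge_some:
  fixes p f :: "'a \<Rightarrow> real"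
  assumes W: "finite W" and p: "\<And>w. w \<in> W \<Longrightarrow> 0 \<le> p w" and pos: "0 < (\<Sum>w\<in>W. p w)"
  shows "\<exists>w\<in>W. 0 < p w \<and> f w \<le> (\<Sum>w\<in>W. p w * f w) / (\<Sum>w\<in>W. p w)"
proof (rule ccontr)
  define t where "t = (\<Sum>w\<in>W. p w * f w) / (\<Sum>w\<in>W. p w)"
  assume "\<not> ?thesis"
  then have f: "t < f w" if "w \<in> W" "0 < p w" for w using that by (force simp: t_def not_le)
  obtain v where v: "v \<in> W" "0 < p v" using pos sum_nonpos[of W p] by (meson not_le)
  have "0 < (\<Sum>w\<in>W. p w * (f w - t))"
  proof (rule sum_pos2[OF W v(1)])
    show "0 < p v * (f v - t)" using v f by simp
    show "0 \<le> p w * (f w - t)" if "w \<in> W" for w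
      using p[OF that] f[OF that] by (cases "p w = 0") auto
  qed
  also have "\<dots> = (\<Sum>w\<in>W. p w * f w) - t * (\<Sum>w\<in>W. p w)"
    by (simp add: right_diff_distrib sum_subtractf sum_distrib_left mult.commute)
  also have "\<dots> = 0" using pos by (simp add: t_def)
  finally show False by simp
qed

lemma weighted_mean_le_some:
  fixes p f :: "'a \<Rightarrow> real"
  assumes W: "finite W" and p: "\<And>w. w \<in> W \<Longrightarrow> 0 \<le> p w" and pos: "0 < (\<Sum>w\<in>W. p w)"
  shows "\<exists>w\<in>W. 0 < p w \<and> (\<Sum>w\<in>W. p w * f w) / (\<Sum>w\<in>W. p w) \<le> f w"
  using weighted_mean_ge_some[OF W p pos, of "\<lambda>w. - f w"] by (auto simp: sum_negf)

lemma cov1_le: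
  assumes "finite C" "C \<subseteq> X" "\<And>z. z \<in> Z \<Longrightarrow> z \<in> X \<and> (\<exists>c\<in>C. D c z \<le> 1)"
  shows "cov1 X D Z \<le> enat (card C)"
  unfolding cov1_def using assms by (intro INF_lower) auto

text \<open>A finite infimum excludes the empty family, whose infimum is infinite, and a nonempty
  set of \<open>enat\<close> has a least element.\<close>

lemma cov1_attained:
  assumes "cov1 X D Z = enat n"
  shows "\<exists>C. finite C \<and> C \<subseteq> X \<and> card C = n \<and> (\<forall>z\<in>Z. \<exists>c\<in>C. D c z \<le> 1)"
proof -
  define A where "A = (\<lambda>C. enat (card C)) ` {C. C \<subseteq> X \<and> finite C \<and> Z \<subseteq> (\<Union>c\<in>C. {x\<in>X. D c x \<le> 1})}"
  have inf: "Inf A = enat n" using assms by (simp add: cov1_def A_def)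
  then have "A \<noteq> {}" by (auto simp: Inf_enat_def)
  then have "Inf A \<in> A" unfolding Inf_enat_def by (auto intro: LeastI)
  then show ?thesis unfolding inf unfolding A_def by force
qed

section \<open>Covering a bump's support within one slice\<close>

text \<open>This is \<open>(2 * (4 * N + 1) + 1) ^ (D + 1)\<close> with
  \<open>N = 4 * (D + 1)\<close>, the size of the grid in \<open>patch_cover\<close>.\<close>

definition patch_count :: "nat \<Rightarrow> nat" where
  "patch_count D = (32 * (D + 1) + 3) ^ (D + 1)"

text \<open>In a slice the first k coordinates of points and centres agree and add nothing to the
  distance. In the other D + 1 the support has size and height of order \<open>side w\<close>, so
  the count depends neither on \<open>w\<close> nor on y.\<close>

lemma patch_cover:
  "\<exists>C. finite C \<and> C \<subseteq> hyp (k + D + 1) \<and> card C \<le> patch_count D \<and>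
     (\<forall>x\<in>hyp (k + D + 1). (\<forall>i<k. x i = y i) \<longrightarrow> 0 < bump k D w x \<longrightarrow> (\<exists>c\<in>C. hdist (k + D + 1) c x \<le> 1))"
proof -
  let ?d = "k + D + 1"
  \<comment> \<open>Mesh s / N makes the squared Euclidean error at most
    \<open>(D + 1) * (s / N)^2 \<le> s^2 / 8\<close>, as \<open>hdist_le_1I\<close> requires for two
    heights of at least s / 2.\<close>
  define N where "N = 4 * (real D + 1)"
  have N: "1 \<le> N" by (simp add: N_def)
  define s where "s = side w"
  have s: "0 < s" by (simp add: s_def)
  define b where "b i = (if i < D then N * real_of_int (snd w i) else 0)" for i
  define B where "B = {v \<in> extensional {..<D + 1}. \<forall>i<D + 1. \<bar>real_of_int (v i) - b i\<bar> \<le> 4 * N + 1}"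
  have B: "finite B" "real (card B) \<le> (2 * (4 * N + 1) + 1) ^ (D + 1)"
    unfolding B_def using N int_box_card[of "4 * N + 1" "D + 1" b] by auto
  have cB: "card B \<le> patch_count D"
  proof -
    have "2 * (4 * N + 1) + 1 = real (32 * (D + 1) + 3)" by (simp add: N_def)
    then show ?thesis using B(2) unfolding patch_count_def of_nat_power[symmetric] by (simp only: of_nat_le_iff flip: of_nat_power)
  qed
  define cen where "cen v i = (if i < k then y i else if i < ?d then s / N * real_of_int (v (i - k)) else 0)" for v :: "nat \<Rightarrow> int" and i
  \<comment> \<open>The restriction to \<open>0 < v D\<close> keeps the centres in the
    half-space.\<close>
  define C where "C = cen ` {v\<in>B. 0 < v D}"
  have "finite C" using B by (simp add: C_def)
  moreover have "C \<subseteq> hyp ?d" using s N by (auto simp: C_def hyp_def cen_def)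
  moreover have "card C \<le> patch_count D"
  proof -
    have "card C \<le> card {v\<in>B. 0 < v D}" unfolding C_def using B by (intro card_image_le) auto
    also have "\<dots> \<le> card B" using B by (intro card_mono) auto
    finally show ?thesis using cB by simp
  qed
  moreover have "\<exists>c\<in>C. hdist ?d c x \<le> 1"
    if x: "x \<in> hyp ?d" "\<forall>i<k. x i = y i" "0 < bump k D w x" for x
  proof -
    note bp = bump_posD[OF x(3), folded s_def]
    \<comment> \<open>Rounding up makes the centre at least as high as x, hence higher than s /
      2.\<close>
    define v where "v = restrict (\<lambda>i. \<lceil>x (k + i) / (s / N)\<rceil>) {..<D + 1}"
    have vi: "v i = \<lceil>x (k + i) / (s / N)\<rceil>" if "i < D + 1" for i using that by (simp add: v_def)
    have "\<bar>real_of_int (v i) - b i\<bar> \<le> 4 * N + 1" if "i < D + 1" for i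
    proof -
      have "\<bar>x (k + i) / (s / N) - b i\<bar> \<le> 4 * N"
      proof (cases "i < D")
        case True
        have "x (k + i) / (s / N) - b i = (x (k + i) - corner w i) * (N / s)"
          using True s N by (simp add: b_def corner_def s_def[symmetric] field_simps)
        then have "\<bar>x (k + i) / (s / N) - b i\<bar> = \<bar>x (k + i) - corner w i\<bar> * (N / s)"
          using s N by (simp add: abs_mult)
        also have "\<dots> \<le> 4 * s * (N / s)" using bp(1)[OF True] s N by (intro mult_right_mono) auto
        also have "\<dots> = 4 * N" using s by simp
        finally show ?thesis .
      next
        case False
        then have i: "i = D" using that by simp
        have "0 < x (k + D)" using x(1) by (simp add: hyp_def)
        then have "\<bar>x (k + i) / (s / N) - b i\<bar> = x (k + D) * (N / s)" using i s N by (simp add: b_def)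
        also have "\<dots> \<le> 4 * s * (N / s)" using bp(3) s N by (intro mult_right_mono) auto
        also have "\<dots> = 4 * N" using s by simp
        finally show ?thesis .
      qed
      then show ?thesis unfolding vi[OF that] by linarith
    qed
    then have vB: "v \<in> B" by (simp add: B_def v_def)
    have xh: "s / 2 < x (k + D)" by (rule bp(2))
    have near: "x (k + i) \<le> s / N * real_of_int (v i) \<and> s / N * real_of_int (v i) \<le> x (k + i) + s / N" if "i < D + 1" for i
    proof -
      define u where "u = x (k + i) / (s / N)"
      have xu: "x (k + i) = s / N * u" using s N by (simp add: u_def)
      have "u \<le> real_of_int (v i)" "real_of_int (v i) \<le> u + 1" unfolding vi[OF that] u_def[symmetric] by linarith+
      then have "s / N * u \<le> s / N * real_of_int (v i)" "s / N * real_of_int (v i) \<le> s / N * (u + 1)"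
        using s N by (auto intro!: mult_left_mono divide_right_mono)
      then show ?thesis unfolding xu by (simp add: distrib_left)
    qed
    have vD: "0 < v D"
    proof -
      have "0 < s / N * real_of_int (v D)" using near[of D] xh s by auto
      moreover have "0 < s / N" using s N by simp
      ultimately have "0 < real_of_int (v D)" using zero_less_mult_pos by blast
      then show ?thesis by simp
    qed
    have cC: "cen v \<in> C" using vB vD by (simp add: C_def)
    have "cen v (?d - 1) = s / N * real_of_int (v D)" by (simp add: cen_def)
    then have ch: "s / 2 \<le> cen v (?d - 1)" using near[of D] xh by linarith
    have "(\<Sum>i<?d. (cen v i - x i)\<^sup>2) \<le> (\<Sum>i<?d. if i < k then 0 else (s / N)\<^sup>2)"
    proof (rule sum_mono)
      fix i assume i: "i \<in> {..<?d}"
      show "(cen v i - x i)\<^sup>2 \<le> (if i < k then 0 else (s / N)\<^sup>2)"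
      proof (cases "i < k")
        case True
        then show ?thesis using x(2) by (simp add: cen_def)
      next
        case False
        then have "cen v i = s / N * real_of_int (v (i - k))" using i by (simp add: cen_def)
        moreover have ik: "i - k < D + 1" "k + (i - k) = i" using i False by auto
        ultimately have "0 \<le> cen v i - x i" "cen v i - x i \<le> s / N"
          using near[OF ik(1), unfolded ik(2)] by linarith+
        then show ?thesis using False by (simp add: power_mono)
      qed
    qed
    also have "\<dots> = (real D + 1) * (s / N)\<^sup>2"
    proof -
      have "{..<?d} \<inter> - {i. i < k} = {k..<?d}" by auto
      then show ?thesis by (subst sum.If_cases) simp_all
    qed
    also have "\<dots> = s\<^sup>2 / (16 * (real D + 1))"
    proof -
      define e where "e = real D + 1"
      have "0 < e" by (simp add: e_def)
      then show ?thesis unfolding N_def e_def[symmetric] by (simp add: power2_eq_square field_simps)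
    qed
    also have "\<dots> \<le> s\<^sup>2 / 8" by (intro divide_left_mono) auto
    also have "\<dots> = (s / 2) * (s / 2) / 2" by (simp add: power2_eq_square)
    also have "\<dots> \<le> cen v (?d - 1) * x (?d - 1) / 2"
      using ch xh s by (intro divide_right_mono mult_mono) auto
    finally have "hdist ?d (cen v) x \<le> 1"
      using cC \<open>C \<subseteq> hyp ?d\<close> x(1) by (intro hdist_le_1I) auto
    then show ?thesis using cC by blast
  qed
  ultimately show ?thesis by blast
qed

definition cell_mean :: "nat \<Rightarrow> nat \<Rightarrow> cell set \<Rightarrow> (cell \<Rightarrow> nat) \<Rightarrow> (nat \<Rightarrow> real) \<Rightarrow> real" where
  "cell_mean k D W idx x = (\<Sum>w\<in>W. bump k D w x * real (idx w)) / (\<Sum>w\<in>W. bump k D w x)"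

definition slice_map :: "nat \<Rightarrow> nat \<Rightarrow> cell set \<Rightarrow> (cell \<Rightarrow> nat) \<Rightarrow> (nat \<Rightarrow> real) \<Rightarrow> nat \<Rightarrow> real" where
  "slice_map k D W idx x i = (if i < k then x i else if i = k then cell_mean k D W idx x else 0)"

context
  fixes k D :: nat and Z :: "(nat \<Rightarrow> real) set" and W :: "cell set" and idx :: "cell \<Rightarrow> nat"
  assumes Z: "Z \<subseteq> hyp (k + D + 1)" and W: "finite W" and cellW: "cell_of k D ` Z \<subseteq> W"
begin

lemma bump_sum_pos:
  assumes "z \<in> Z"
  shows "0 < (\<Sum>w\<in>W. bump k D w z)"
proof (rule sum_pos2[OF W, of "cell_of k D z"])
  show "cell_of k D z \<in> W" using assms cellW by auto
  show "0 < bump k D (cell_of k D z) z" using assms Z by (intro bump_cell_of_pos) (auto simp: hyp_def)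
qed (rule bump_nonneg)

lemma slice_map_cont: "cont_into (hdist (k + D + 1)) Z (k + 1) (slice_map k D W idx)"
proof -
  let ?f = "slice_map k D W idx" and ?d = "k + D + 1"
  have "\<exists>\<delta>>0. \<forall>w\<in>Z. hdist ?d z w < \<delta> \<longrightarrow> eucl_dist (k + 1) (?f w) (?f z) < e"
    if z: "z \<in> Z" and e: "0 < e" for z e
  proof -
    have "((\<lambda>w. cell_mean k D W idx w) \<longlongrightarrow> cell_mean k D W idx z) (hfilter ?d Z z)"
      unfolding cell_mean_def using bump_sum_pos[OF z] by (intro tendsto_intros tendsto_bump Z z) auto
    then have c: "((\<lambda>w. ?f w i) \<longlongrightarrow> ?f z i) (hfilter ?d Z z)" for i
      using tendsto_coord_hfilter[OF Z z, of i] by (auto simp: slice_map_def)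
    have "((\<lambda>w. eucl_dist (k + 1) (?f w) (?f z)) \<longlongrightarrow> sqrt (\<Sum>i<k + 1. (?f z i - ?f z i)\<^sup>2)) (hfilter ?d Z z)"
      unfolding eucl_dist_def by (intro tendsto_intros c)
    then have "eventually (\<lambda>w. eucl_dist (k + 1) (?f w) (?f z) < e) (hfilter ?d Z z)"
      using e by (intro order_tendstoD(2)) auto
    then show ?thesis using Z z by (rule eventually_hfilterD)
  qed
  moreover have "?f ` Z \<subseteq> Rq (k + 1)" by (auto simp: Rq_def slice_map_def)
  ultimately show ?thesis by (auto simp: cont_into_def)
qed

text \<open>At a point of the fibre \<open>y k\<close> is a mean, so among the cells with positive
  bump one has number at most \<open>y k\<close> and one at least \<open>y k\<close>. They are
  adjacent, so the first is in the cut, and its patch in the slice covers the point.\<close>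

lemma slice_map_fibre:
  "cov1 (hyp (k + D + 1)) (hdist (k + D + 1)) {z\<in>Z. slice_map k D W idx z = y}
    \<le> enat (card (cut_set (adj D) W idx (y k)) * patch_count D)"
proof -
  let ?d = "k + D + 1"
  obtain C where C: "\<And>w. finite (C w)" "\<And>w. C w \<subseteq> hyp ?d" "\<And>w. card (C w) \<le> patch_count D"
    "\<And>w x. \<lbrakk>x \<in> hyp ?d; \<forall>i<k. x i = y i; 0 < bump k D w x\<rbrakk> \<Longrightarrow> \<exists>c\<in>C w. hdist ?d c x \<le> 1"
    using patch_cover[of k D y] by metis
  let ?K = "cut_set (adj D) W idx (y k)"
  have finK: "finite ?K" using W by (simp add: cut_set_def)
  have cov: "z \<in> hyp ?d \<and> (\<exists>c\<in>(\<Union>w\<in>?K. C w). hdist ?d c z \<le> 1)"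
    if "z \<in> {z\<in>Z. slice_map k D W idx z = y}" for z
  proof -
    have z: "z \<in> Z" "z \<in> hyp ?d" and y: "y = slice_map k D W idx z" using that Z by auto
    have yk: "y k = cell_mean k D W idx z" and yi: "\<forall>i<k. z i = y i" by (simp_all add: y slice_map_def)
    obtain w where w: "w \<in> W" "0 < bump k D w z" "real (idx w) \<le> y k"
      using weighted_mean_ge_some[OF W bump_nonneg bump_sum_pos[OF z(1)], of "\<lambda>w. real (idx w)"]
      by (auto simp: yk cell_mean_def)
    obtain w' where w': "w' \<in> W" "0 < bump k D w' z" "y k \<le> real (idx w')"
      using weighted_mean_le_some[OF W bump_nonneg bump_sum_pos[OF z(1)], of "\<lambda>w. real (idx w)"]
      by (auto simp: yk cell_mean_def)
    have "w \<in> ?K" using w w' bump_adj[OF w(2) w'(2)] by (auto simp: cut_set_def)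
    then show ?thesis using C(4)[OF z(2) yi w(2)] z(2) by blast
  qed
  have "cov1 (hyp ?d) (hdist ?d) {z\<in>Z. slice_map k D W idx z = y} \<le> enat (card (\<Union>w\<in>?K. C w))"
    by (rule cov1_le[OF _ _ cov]) (intro finite_UN_I finK UN_least C(1,2))+
  also have "card (\<Union>w\<in>?K. C w) \<le> (\<Sum>w\<in>?K. card (C w))" using finK by (rule card_UN_le)
  also have "\<dots> \<le> card ?K * patch_count D" using sum_bounded_above[of ?K "\<lambda>w. card (C w)", OF C(3)] by simp
  finally show ?thesis by simp
qed

end

section \<open>From cut bounds to the growth of \<open>TOX\<close>\<close>

text \<open>A cover by n balls limits the number of cells meeting Z to
  \<open>5 * 51 ^ D * n\<close>; every fibre then costs one patch per cell of a cut.\<close>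

lemma TO_le_cut_bound:
  assumes H: "\<And>W. \<lbrakk>finite W; W \<subseteq> cells D\<rbrakk> \<Longrightarrow> \<exists>idx. \<forall>t. real (card (cut_set (adj D) W idx t)) \<le> H (card W)"
    and mono: "\<And>m n. m \<le> n \<Longrightarrow> H m \<le> H n"
    and Z: "Z \<subseteq> hyp (k + D + 1)" and cov: "cov1 (hyp (k + D + 1)) (hdist (k + D + 1)) Z = enat n"
  shows "TO (hyp (k + D + 1)) (hdist (k + D + 1)) (k + 1) Z
    \<le> enat (nat \<lfloor>H (5 * 51 ^ D * n)\<rfloor> * patch_count D)"
proof -
  let ?d = "k + D + 1"
  obtain C where C: "finite C" "C \<subseteq> hyp ?d" "card C = n" "\<And>z. z \<in> Z \<Longrightarrow> \<exists>c\<in>C. hdist ?d c z \<le> 1"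
    using cov1_attained[OF cov] by blast
  define W where "W = cell_of k D ` Z"
  define U where "U c = cell_of k D ` {x \<in> hyp ?d. hdist ?d c x \<le> 1}" for c
  have U: "finite (U c)" "card (U c) \<le> 5 * 51 ^ D" if "c \<in> C" for c
    using cells_meeting_ball[of c k D] that C(2) by (auto simp: U_def)
  have sub: "W \<subseteq> (\<Union>c\<in>C. U c)" using C(4) Z by (fastforce simp: W_def U_def)
  have finU: "finite (\<Union>c\<in>C. U c)" using C(1) U by auto
  have finW: "finite W" using sub finU by (rule finite_subset)
  have "card W \<le> card (\<Union>c\<in>C. U c)" by (rule card_mono[OF finU sub])
  also have "\<dots> \<le> (\<Sum>c\<in>C. card (U c))" using C(1) by (rule card_UN_le)
  also have "\<dots> \<le> 5 * 51 ^ D * n" using sum_bounded_above[of C "\<lambda>c. card (U c)", OF U(2)] C(3) by (simp add: mult.commute)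
  finally have cW: "card W \<le> 5 * 51 ^ D * n" .
  have "W \<subseteq> cells D" by (auto simp: W_def cell_of_in_cells)
  then obtain idx where idx: "\<And>t. real (card (cut_set (adj D) W idx t)) \<le> H (card W)" using H[OF finW] by blast
  have cut: "card (cut_set (adj D) W idx t) \<le> nat \<lfloor>H (5 * 51 ^ D * n)\<rfloor>" for t
    using idx[of t] mono[OF cW] by (simp add: le_nat_floor)
  note ctx = Z finW W_def[THEN equalityD2]
  have "Ov (hyp ?d) (hdist ?d) Z (slice_map k D W idx) \<le> enat (nat \<lfloor>H (5 * 51 ^ D * n)\<rfloor> * patch_count D)"
    unfolding Ov_def
  proof (rule SUP_least)
    fix y
    have "cov1 (hyp ?d) (hdist ?d) {z\<in>Z. slice_map k D W idx z = y}
        \<le> enat (card (cut_set (adj D) W idx (y k)) * patch_count D)"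
      by (rule slice_map_fibre[OF ctx])
    also have "\<dots> \<le> enat (nat \<lfloor>H (5 * 51 ^ D * n)\<rfloor> * patch_count D)"
      using mult_right_mono[OF cut, of "patch_count D"] by simp
    finally show "cov1 (hyp ?d) (hdist ?d) {z\<in>Z. slice_map k D W idx z = y}
        \<le> enat (nat \<lfloor>H (5 * 51 ^ D * n)\<rfloor> * patch_count D)" .
  qed
  moreover have "TO (hyp ?d) (hdist ?d) (k + 1) Z \<le> Ov (hyp ?d) (hdist ?d) Z (slice_map k D W idx)"
    unfolding TO_def using slice_map_cont[OF ctx] by (intro INF_lower) auto
  ultimately show ?thesis by (rule order_trans[rotated])
qed

lemma lesssim_TOX:
  assumes H: "\<And>W. \<lbrakk>finite W; W \<subseteq> cells D\<rbrakk> \<Longrightarrow> \<exists>idx. \<forall>t. real (card (cut_set (adj D) W idx t)) \<le> H (card W)"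
    and mono: "\<And>m n. m \<le> n \<Longrightarrow> H m \<le> H n" and H0: "\<And>n. 0 \<le> H n"
    and g: "0 < c" "\<And>n r. real n \<le> r \<Longrightarrow> H (5 * 51 ^ D * n) \<le> c * g (5 * 51 ^ D * r) + c"
    and gm: "\<And>x y. 0 \<le> x \<Longrightarrow> x \<le> y \<Longrightarrow> 0 \<le> g x \<and> g x \<le> g y"
  shows "lesssim (TOX (hyp (k + D + 1)) (hdist (k + D + 1)) (k + 1)) g"
proof -
  let ?X = "hyp (k + D + 1)" and ?h = "hdist (k + D + 1)"
  define K0 where "K0 = (5 * 51 ^ D :: real)"
  have K0: "0 < K0" by (simp add: K0_def)
  define P where "P = real (patch_count D)"
  have P: "0 \<le> P" by (simp add: P_def)
  \<comment> \<open>In \<open>lesssim\<close> a single constant scales the argument, the value and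
    the summand, so M dominates both K0 and \<open>c * P\<close>; monotonicity of g permits the
    larger argument.\<close>
  define M where "M = max K0 (c * P)"
  have M: "0 < M" "K0 \<le> M" "c * P \<le> M" using K0 by (auto simp: M_def)
  have "\<exists>n. TOX ?X ?h (k + 1) r = enat n \<and> real n \<le> M * g (M * r) + M" if r: "0 \<le> r" for r
  proof -
    \<comment> \<open>Covering numbers are integers, so the floor of r bounds those of all
      admissible Z at once.\<close>
    define N where "N = nat \<lfloor>H (5 * 51 ^ D * nat \<lfloor>r\<rfloor>)\<rfloor> * patch_count D"
    have "TOX ?X ?h (k + 1) r \<le> enat N"
      unfolding TOX_def
    proof (rule SUP_least)
      fix Z assume "Z \<in> {Z. Z \<subseteq> ?X \<and> (\<exists>n. cov1 ?X ?h Z = enat n \<and> real n \<le> r)}"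
      then obtain n where Z: "Z \<subseteq> ?X" and n: "cov1 ?X ?h Z = enat n" "real n \<le> r" by blast
      have "n \<le> nat \<lfloor>r\<rfloor>" using n(2) by (simp add: le_nat_floor)
      then have "H (5 * 51 ^ D * n) \<le> H (5 * 51 ^ D * nat \<lfloor>r\<rfloor>)" by (intro mono) simp
      then have "nat \<lfloor>H (5 * 51 ^ D * n)\<rfloor> * patch_count D \<le> N"
        unfolding N_def by (intro mult_right_mono nat_mono floor_mono) auto
      then show "TO ?X ?h (k + 1) Z \<le> enat N"
        using TO_le_cut_bound[OF H mono Z n(1)] by (meson enat_ord_simps(1) order_trans)
    qed
    then obtain n where n: "TOX ?X ?h (k + 1) r = enat n" "n \<le> N"
      by (cases "TOX ?X ?h (k + 1) r") auto
    have fl: "real (nat \<lfloor>r\<rfloor>) \<le> r" using r by simp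
    have "real n \<le> real N" using n(2) by simp
    also have "\<dots> \<le> H (5 * 51 ^ D * nat \<lfloor>r\<rfloor>) * P"
      using H0 P unfolding N_def of_nat_mult P_def by (intro mult_right_mono) auto
    also have "\<dots> \<le> (c * g (K0 * r) + c) * P"
      using g(2)[OF fl] P unfolding K0_def by (intro mult_right_mono) auto
    also have "\<dots> = c * P * g (K0 * r) + c * P" by (simp add: algebra_simps)
    also have "\<dots> \<le> M * g (M * r) + M"
    proof -
      have "K0 * r \<le> M * r" "0 \<le> K0 * r" using M r K0 by (auto intro: mult_right_mono)
      then have "0 \<le> g (K0 * r)" "g (K0 * r) \<le> g (M * r)" using gm by blast+
      then show ?thesis using M by (intro add_mono mult_mono) auto
    qed
    finally show ?thesis using n(1) by blast
  qed
  then show ?thesis unfolding lesssim_def using M(1) by blast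
qed

theorem theorem1p12:
  shows "(\<forall>d q :: nat. 2 \<le> q \<and> q + 2 \<le> d \<longrightarrow>
            lesssim (TOX (hyp d) (hdist d) q) (\<lambda>r. r powr (1 - 1 / (real d - real q))))
       \<and> (\<forall>d :: nat. 2 \<le> d \<longrightarrow>
            lesssim (TOX (hyp d) (hdist d) (d - 1)) (\<lambda>r. (ln (1 + r))^2))"
proof (intro conjI allI impI)
  fix d q :: nat
  assume dq: "2 \<le> q \<and> q + 2 \<le> d"
  \<comment> \<open>The projection keeps q - 1 coordinates and the averaged numbering is the q-th;
    the fibres of the projection have dimension \<open>D + 1\<close>.\<close>
  define k where "k = q - 1"
  define D where "D = d - q"
  have D: "2 \<le> D" and eq: "d = k + D + 1" "q = k + 1" using dq by (auto simp: k_def D_def)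
  define \<alpha> where "\<alpha> = 1 - 1 / real D"
  have \<alpha>: "0 \<le> \<alpha>" using D by (simp add: \<alpha>_def)
  obtain M where M: "0 < M" and cut: "\<And>W. \<lbrakk>finite W; W \<subseteq> cells D\<rbrakk> \<Longrightarrow>
      \<exists>idx. \<forall>t. real (card (cut_set (adj D) W idx t)) \<le> M * real (card W) powr \<alpha>"
    using cut_bound_power[OF D] unfolding \<alpha>_def by blast
  have "lesssim (TOX (hyp (k + D + 1)) (hdist (k + D + 1)) (k + 1)) (\<lambda>r. r powr \<alpha>)"
  proof (rule lesssim_TOX[where H = "\<lambda>n. M * real n powr \<alpha>", OF cut])
    show "M * real m powr \<alpha> \<le> M * real n powr \<alpha>" if "m \<le> n" for m n
      using that M \<alpha> by (intro mult_left_mono powr_mono2) auto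
    show "M * real (5 * 51 ^ D * n) powr \<alpha> \<le> M * (5 * 51 ^ D * r) powr \<alpha> + M" if "real n \<le> r" for n r
    proof -
      have "real (5 * 51 ^ D * n) \<le> 5 * 51 ^ D * r" using that by simp
      then have "real (5 * 51 ^ D * n) powr \<alpha> \<le> (5 * 51 ^ D * r) powr \<alpha>"
        using \<alpha> by (intro powr_mono2) auto
      then have "M * real (5 * 51 ^ D * n) powr \<alpha> \<le> M * (5 * 51 ^ D * r) powr \<alpha>" using M by (intro mult_left_mono) auto
      then show ?thesis using M by linarith
    qed
  qed (use M \<alpha> in \<open>auto intro: powr_mono2\<close>)
  moreover have "real d - real q = real D" by (simp add: eq)
  ultimately show "lesssim (TOX (hyp d) (hdist d) q) (\<lambda>r. r powr (1 - 1 / (real d - real q)))"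
    unfolding \<alpha>_def by (simp only: eq)
next
  fix d :: nat
  assume "2 \<le> d"
  define k where "k = d - 2"
  have eq: "d = k + 1 + 1" using \<open>2 \<le> d\<close> by (auto simp: k_def)
  obtain M where M: "0 < M" and cut: "\<And>W. \<lbrakk>finite W; W \<subseteq> cells 1\<rbrakk> \<Longrightarrow>
      \<exists>idx. \<forall>t. real (card (cut_set (adj 1) W idx t)) \<le> M * (1 + ln (1 + real (card W)))\<^sup>2"
    using cut_bound_log by blast
  have "lesssim (TOX (hyp (k + 1 + 1)) (hdist (k + 1 + 1)) (k + 1)) (\<lambda>r. (ln (1 + r))\<^sup>2)"
  proof (rule lesssim_TOX[where H = "\<lambda>n. M * (1 + ln (1 + real n))\<^sup>2" and c = "2 * M", OF cut])
    show "M * (1 + ln (1 + real m))\<^sup>2 \<le> M * (1 + ln (1 + real n))\<^sup>2" if "m \<le> n" for m n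
      using that M by (intro mult_left_mono power_mono add_left_mono) auto
    show "M * (1 + ln (1 + real (5 * 51 ^ 1 * n)))\<^sup>2 \<le> 2 * M * (ln (1 + 5 * 51 ^ 1 * r))\<^sup>2 + 2 * M"
      if "real n \<le> r" for n r
    proof -
      define a b where "a = ln (1 + real (5 * 51 ^ 1 * n))" and "b = ln (1 + 5 * 51 ^ 1 * r)"
      have ab: "0 \<le> a" "a \<le> b" using that by (simp_all add: a_def b_def)
      \<comment> \<open>Splitting off the 1 inside the square doubles the constant, hence
        \<open>c = 2 * M\<close>.\<close>
      have "(1 + a)\<^sup>2 \<le> 2 * a\<^sup>2 + 2" using zero_le_power2[of "1 - a"] by (simp add: power2_eq_square algebra_simps)
      also have "\<dots> \<le> 2 * b\<^sup>2 + 2" using ab by (simp add: power_mono)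
      finally have "M * (1 + a)\<^sup>2 \<le> M * (2 * b\<^sup>2 + 2)" using M by (intro mult_left_mono) auto
      then show ?thesis unfolding a_def[symmetric] b_def[symmetric] by (simp add: algebra_simps)
    qed
  qed (use M in \<open>auto intro: power_mono\<close>)
  then show "lesssim (TOX (hyp d) (hdist d) (d - 1)) (\<lambda>r. (ln (1 + r))\<^sup>2)"
    by (simp only: eq add_diff_cancel_right')
qed

end
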